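(* There is an absolute constant $C>0$ such that for every $0<\varepsilon\le1$ and $d\in\mathbb{N}$ there exist $\varepsilon',d'>0$ with the following property. For every $n,m$ and all polynomials $P_1,\dots,P_n\colon\mathbb{F}_2^m\to\mathbb{F}_2$ of degree at most $d$, the distribution $\mathcal{P}$ of $(P_1(X),\dots,P_n(X))$ for $X$ uniform on $\mathbb{F}_2^m$ satisfies \[ \|\mathcal{P}-\mathrm{Ber}(1/3)^{\otimes n}\|_{\mathtt{TV}}\ \ge\ 1-C d' n^{-\varepsilon'}-C\varepsilon . \] Consequently, for each fixed $d$ there is a function $\eta_d(n)\to0$ as $n\to\infty$ such that every such $\mathcal{P}$ satisfies $\|\mathcal{P}-\mathrm{Ber}(1/3)^{\otimes n}\|_{\mathtt{TV}}\ge1-\eta_d(n)$.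
   Context: Total variation distance: $\frac12\sum_x|\mathcal{D}_1(x)-\mathcal{D}_2(x)|$; $\mathrm{Ber}(1/3)^{\otimes n}$ is the product of $n$ independent Bernoulli$(1/3)$ bits. *)

theory Defs
  imports "HOL-Analysis.Analysis"
begin

text \<open>F_2 is modelled by bool (True = 1, xor = addition, conjunction = product).
  Vectors in F_2^m are boolean lists of length m.\<close>

definition cube :: "nat \<Rightarrow> bool list set" where
  "cube m = {xs. length xs = m}"

text \<open>A function F_2^m -> F_2 is a polynomial of degree at most d iff it equals
  a sum (xor) of monomials prod_{i in S} x_i with |S| <= d (multilinear normal form;
  since x^2 = x on F_2 every polynomial of degree <= d has this form).\<close>
definition poly_deg_le :: "nat \<Rightarrow> nat \<Rightarrow> (bool list \<Rightarrow> bool) \<Rightarrow> bool" where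
  "poly_deg_le m d f \<longleftrightarrow>
     (\<exists>M. M \<subseteq> {S. S \<subseteq> {..<m} \<and> card S \<le> d} \<and>
          (\<forall>x\<in>cube m. f x = odd (card {S\<in>M. \<forall>i\<in>S. x ! i})))"

definition poly_distr :: "nat \<Rightarrow> nat \<Rightarrow> (nat \<Rightarrow> bool list \<Rightarrow> bool) \<Rightarrow> bool list \<Rightarrow> real" where
  "poly_distr m n Ps y =
     real (card {x\<in>cube m. map (\<lambda>i. Ps i x) [0..<n] = y}) / 2 ^ m"

definition ber13 :: "nat \<Rightarrow> bool list \<Rightarrow> real" where
  "ber13 n y = (if length y = n
     then (1/3) ^ length (filter id y) * (2/3) ^ length (filter Not y) else 0)"

definition tv_dist :: "nat \<Rightarrow> (bool list \<Rightarrow> real) \<Rightarrow> (bool list \<Rightarrow> real) \<Rightarrow> real" where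
  "tv_dist n p q = (1/2) * (\<Sum>y\<in>cube n. \<bar>p y - q y\<bar>)"

end

(*
  For fixed degree and tolerance it suffices to exclude a sequence of counterexamples, n_N > N.
  The mass shared with Ber(1/3)^n gives weights w_N on the inputs under which the output bits are
  dominated by independent Bernoulli(1/3) bits. Along a free ultrafilter U on the indices N we
  study sequences of polynomials up to sets of measure tending to 0.

  Structure theorem (biased_struct): a biased polynomial is almost everywhere a function of
  finitely many polynomials of lower degree. Its random derivatives vote for an approximation A;
  as P(x) is the sum of P over the other vertices of any parallelepiped at x, the values of A there
  decide P(x). Written through polynomials that are regular over x, this vote depends only on
  polynomials in x alone.

  For the theorem, real parameters s in [0,1) select uncountably many bits p_s = P_[Ns]. By
  regularization, on an uncountable set p_s is a function of a finite family R0 that does not depend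
  on s and of a family R1(s) none of whose combinations correlates with w on an atom of R0.
  So on each atom the w-average of (-1)^p_s is a dyadic multiple of the mass of the atom,
  whereas domination forces it to be 1/3 of that mass, for all but countably many s. Hence w has
  mass tending to 0. Uncountability makes every choice from a countable set of types uniform.
*)

theory Submission
  imports Defs "HOL-Library.Multiset_Order"
begin

section \<open>Polynomials on the cube\<close>

text \<open>The theorem asks for no rate: d' may depend on \<epsilon> and d, so a threshold for n
  beyond which the distance is at least 1 - \<epsilon> suffices, and a compactness argument becomes
  possible. The obstacle is that R0 must be common to all s. Bessel's inequality limits how many
  output signs deviate from mean 1/3 under one fixed weight; the atoms of a family varying with s
  would be a different weight for each s, and nothing would follow. So an offending combination q_s
  is not broken up by itself. A second use of Bessel's inequality provides one index t such that q_s
  + q_t is biased for uncountably many s; q_t joins R0, and the structure theorem replaces the sum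
  by polynomials of lower degree. The structure theorem follows the same scheme, with polynomials in
  x alone in the role of R0: freezing the directions z of q(x, z) at a suitable z' gives the partner
  of q.\<close>

definition vadd :: "bool list \<Rightarrow> bool list \<Rightarrow> bool list" (infixl "\<oplus>" 65) where
  "x \<oplus> y = map2 (\<noteq>) x y"

lemma length_vadd [simp]: "length (x \<oplus> y) = min (length x) (length y)"
  by (simp add: vadd_def)

lemma nth_vadd [simp]: "i < length x \<Longrightarrow> i < length y \<Longrightarrow> (x \<oplus> y) ! i = (x ! i \<noteq> y ! i)"
  by (simp add: vadd_def)

lemma vadd_commute: "x \<oplus> y = y \<oplus> x"
  by (auto intro!: nth_equalityI)

lemma vadd_assoc: "x \<oplus> y \<oplus> z = x \<oplus> (y \<oplus> z)"
  by (auto intro!: nth_equalityI)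

lemma vadd_right_commute: "x \<oplus> y \<oplus> z = x \<oplus> z \<oplus> y"
  by (auto intro!: nth_equalityI)

lemma vadd_cancel: "length x = length y \<Longrightarrow> x \<oplus> y \<oplus> y = x"
  by (auto intro!: nth_equalityI)

lemma vadd_append: "length x = length y \<Longrightarrow> (x @ u) \<oplus> (y @ v) = (x \<oplus> y) @ (u \<oplus> v)"
  by (simp add: vadd_def)

lemma take_vadd: "take n (x \<oplus> y) = take n x \<oplus> take n y"
  by (simp add: vadd_def take_map take_zip)

lemma drop_vadd: "drop n (x \<oplus> y) = drop n x \<oplus> drop n y"
  by (simp add: vadd_def drop_map drop_zip)

lemma in_cube: "x \<in> cube m \<longleftrightarrow> length x = m"
  by (simp add: cube_def)

lemma vadd_in_cube [simp]: "x \<in> cube m \<Longrightarrow> y \<in> cube m \<Longrightarrow> x \<oplus> y \<in> cube m"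
  by (simp add: in_cube)

lemma replicate_in_cube [simp]: "replicate m b \<in> cube m"
  by (simp add: in_cube)

lemma cube_eq: "cube m = {xs. set xs \<subseteq> UNIV \<and> length xs = m}"
  by (simp add: cube_def)

lemma finite_cube [simp]: "finite (cube m)"
  unfolding cube_eq by (rule finite_lists_length_eq) simp

lemma card_cube: "card (cube m) = 2 ^ m"
  unfolding cube_eq by (subst card_lists_length_eq) (auto simp: card_UNIV_bool)

lemma cube_nonempty [simp]: "cube m \<noteq> {}"
  using replicate_in_cube by blast

section \<open>Averages over the uniform cube\<close>

definition ex :: "nat \<Rightarrow> (bool list \<Rightarrow> real) \<Rightarrow> real" where
  "ex m g = (\<Sum>x\<in>cube m. g x) / 2 ^ m"

lemma ex_cong: "(\<And>x. x \<in> cube m \<Longrightarrow> f x = g x) \<Longrightarrow> ex m f = ex m g"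
  unfolding ex_def by (auto intro: sum.cong)

lemma ex_add: "ex m (\<lambda>x. f x + g x) = ex m f + ex m g"
  by (simp add: ex_def sum.distrib add_divide_distrib)

lemma ex_diff: "ex m (\<lambda>x. f x - g x) = ex m f - ex m g"
  by (simp add: ex_def sum_subtractf diff_divide_distrib)

lemma ex_cmult: "ex m (\<lambda>x. c * f x) = c * ex m f"
  by (simp add: ex_def flip: sum_distrib_left)

lemma ex_multc: "ex m (\<lambda>x. f x * c) = ex m f * c"
  by (simp add: ex_def flip: sum_distrib_right)

lemma ex_uminus: "ex m (\<lambda>x. - f x) = - ex m f"
  by (simp add: ex_def sum_negf)

lemma ex_const [simp]: "ex m (\<lambda>x. c) = c"
  by (simp add: ex_def card_cube)

lemma ex_sum: "ex m (\<lambda>x. \<Sum>i\<in>I. f i x) = (\<Sum>i\<in>I. ex m (f i))"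
  unfolding ex_def by (subst sum.swap) (simp add: sum_divide_distrib)

lemma ex_mono: "(\<And>x. x \<in> cube m \<Longrightarrow> f x \<le> g x) \<Longrightarrow> ex m f \<le> ex m g"
  unfolding ex_def by (intro divide_right_mono sum_mono) auto

lemma ex_nonneg: "(\<And>x. x \<in> cube m \<Longrightarrow> 0 \<le> f x) \<Longrightarrow> 0 \<le> ex m f"
  unfolding ex_def by (intro divide_nonneg_nonneg sum_nonneg) auto

lemma ex_abs: "\<bar>ex m f\<bar> \<le> ex m (\<lambda>x. \<bar>f x\<bar>)"
  unfolding ex_def by (simp add: divide_right_mono sum_abs)

text \<open>First-moment method: together with \<open>ex_ge_attained\<close> it turns random
  directions into fixed ones.\<close>

lemma ex_le_attained: "\<exists>x\<in>cube m. ex m f \<le> f x"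
proof (rule ccontr)
  assume *: "\<not> ?thesis"
  have "(\<Sum>x\<in>cube m. f x) < (\<Sum>x\<in>cube m. ex m f)"
    using * by (intro sum_strict_mono) (auto simp: not_le)
  then have "ex m f * 2 ^ m < ex m f * 2 ^ m"
    by (simp add: card_cube ex_def)
  then show False by simp
qed

lemma ex_ge_attained: "\<exists>x\<in>cube m. f x \<le> ex m f"
  using ex_le_attained[of m "\<lambda>x. - f x"] by (simp add: ex_uminus)

lemma vadd_vadd_cancel [simp]: "x \<in> cube m \<Longrightarrow> h \<in> cube m \<Longrightarrow> x \<oplus> h \<oplus> h = x"
  by (simp add: in_cube vadd_cancel)

lemma bij_betw_vadd: "h \<in> cube m \<Longrightarrow> bij_betw (\<lambda>x. x \<oplus> h) (cube m) (cube m)"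
  by (rule bij_betw_byWitness[where f' = "\<lambda>x. x \<oplus> h"]) auto

lemma ex_translate: "h \<in> cube m \<Longrightarrow> ex m (\<lambda>x. f (x \<oplus> h)) = ex m f"
  unfolding ex_def by (subst sum.reindex_bij_betw[OF bij_betw_vadd]) auto

lemma ex_translate': "x \<in> cube m \<Longrightarrow> ex m (\<lambda>h. f (x \<oplus> h)) = ex m f"
  using ex_translate[of x m f] by (simp add: vadd_commute)

lemma ex_append: "ex (a + b) g = ex a (\<lambda>x. ex b (\<lambda>z. g (x @ z)))"
proof -
  have "(\<Sum>y\<in>cube (a + b). g y) = (\<Sum>(x, z)\<in>cube a \<times> cube b. g (x @ z))"
    by (rule sum.reindex_bij_witness[of _ "\<lambda>(x, z). x @ z" "\<lambda>y. (take a y, drop a y)"])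
       (auto simp: in_cube)
  then show ?thesis
    by (simp add: ex_def sum.cartesian_product power_add flip: sum_divide_distrib)
qed

lemma ex_swap: "ex a (\<lambda>x. ex b (\<lambda>z. g x z)) = ex b (\<lambda>z. ex a (\<lambda>x. g x z))"
  unfolding ex_def by (simp add: sum_divide_distrib sum.swap[of _ "cube a"] mult.commute)

lemma ex_square_le: "(ex m f)\<^sup>2 \<le> ex m (\<lambda>x. (f x)\<^sup>2)"
proof -
  have "0 \<le> ex m (\<lambda>x. (f x - ex m f)\<^sup>2)"
    by (intro ex_nonneg) simp
  also have "\<dots> = ex m (\<lambda>x. (f x)\<^sup>2 - 2 * ex m f * f x + (ex m f)\<^sup>2)"
    by (intro ex_cong) (simp add: power2_eq_square algebra_simps)
  also have "\<dots> = ex m (\<lambda>x. (f x)\<^sup>2) - (ex m f)\<^sup>2"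
    unfolding ex_add ex_diff ex_cmult ex_const by (simp add: power2_eq_square)
  finally show ?thesis by simp
qed

section \<open>Signs, and degree measured by derivatives\<close>

definition chi :: "bool \<Rightarrow> real" where
  "chi b = (if b then -1 else 1)"

lemma chi_simps [simp]: "chi True = -1" "chi False = 1"
  by (simp_all add: chi_def)

lemma chi_neq: "chi (a \<noteq> b) = chi a * chi b"
  by (simp add: chi_def)

lemma abs_chi [simp]: "\<bar>chi b\<bar> = 1"
  by (simp add: chi_def)

lemma chi_mult_self [simp]: "chi b * chi b = 1"
  by (simp add: chi_def)

text \<open>Degree less than \<open>k\<close>, expressed by the vanishing of all \<open>k\<close>-fold derivatives; \<open>deglt m 0\<close> says that
  the function is 0.\<close>

primrec deglt :: "nat \<Rightarrow> nat \<Rightarrow> (bool list \<Rightarrow> bool) \<Rightarrow> bool" where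
  "deglt m 0 f = (\<forall>x\<in>cube m. \<not> f x)"
| "deglt m (Suc k) f = (\<forall>h\<in>cube m. deglt m k (\<lambda>x. f x \<noteq> f (x \<oplus> h)))"

lemma deglt_cong: "(\<And>x. x \<in> cube m \<Longrightarrow> f x = g x) \<Longrightarrow> deglt m k f = deglt m k g"
proof (induction k arbitrary: f g)
  case (Suc k)
  then have "deglt m k (\<lambda>x. f x \<noteq> f (x \<oplus> h)) = deglt m k (\<lambda>x. g x \<noteq> g (x \<oplus> h))" if "h \<in> cube m" for h
    by (intro Suc.IH) (simp add: Suc.prems that)
  then show ?case by simp
qed simp

lemma deglt_False [simp]: "deglt m k (\<lambda>x. False)"
  by (induction k) auto

lemma deglt_xor: "deglt m k f \<Longrightarrow> deglt m k g \<Longrightarrow> deglt m k (\<lambda>x. f x \<noteq> g x)"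
proof (induction k arbitrary: f g)
  case (Suc k)
  show ?case
    unfolding deglt.simps
  proof
    fix h assume h: "h \<in> cube m"
    have "deglt m k (\<lambda>x. f x \<noteq> f (x \<oplus> h))" "deglt m k (\<lambda>x. g x \<noteq> g (x \<oplus> h))"
      using Suc.prems h by auto
    then have "deglt m k (\<lambda>x. (f x \<noteq> f (x \<oplus> h)) \<noteq> (g x \<noteq> g (x \<oplus> h)))"
      by (rule Suc.IH)
    then show "deglt m k (\<lambda>x. (f x \<noteq> g x) \<noteq> (f (x \<oplus> h) \<noteq> g (x \<oplus> h)))"
      by (rule back_subst[of "deglt m k"]) auto
  qed
qed simp

lemma deglt_Suc: "deglt m k f \<Longrightarrow> deglt m (Suc k) f"
proof (induction k arbitrary: f)
  case 0
  then show ?case by simp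
next
  case (Suc k)
  show ?case
    unfolding deglt.simps(2)[of m "Suc k"]
    using Suc by (metis deglt.simps(2))
qed

lemma deglt_mono: "deglt m k f \<Longrightarrow> k \<le> l \<Longrightarrow> deglt m l f"
  using deglt_Suc by (induction l) (auto simp: le_Suc_eq simp del: deglt.simps)

text \<open>The derivative of \<open>f\<close> after \<open>\<phi>\<close> in direction
  \<open>h\<close> is the derivative of \<open>f\<close> in direction \<open>l h\<close>, taken
  after \<open>\<phi>\<close>. So an affine substitution with linear part \<open>l\<close> does not
  raise the degree.\<close>

lemma deglt_pullback:
  assumes "deglt m k f"
    and "\<And>x. x \<in> cube m' \<Longrightarrow> \<phi> x \<in> cube m"
    and "\<And>h. h \<in> cube m' \<Longrightarrow> l h \<in> cube m"
    and "\<And>x h. x \<in> cube m' \<Longrightarrow> h \<in> cube m' \<Longrightarrow> \<phi> (x \<oplus> h) = \<phi> x \<oplus> l h"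
  shows "deglt m' k (\<lambda>x. f (\<phi> x))"
  using assms
proof (induction k arbitrary: f)
  case (Suc k)
  show ?case
    unfolding deglt.simps
  proof
    fix h assume h: "h \<in> cube m'"
    have "deglt m' k (\<lambda>x. f (\<phi> x) \<noteq> f (\<phi> x \<oplus> l h))"
      using Suc.prems h by (intro Suc.IH) auto
    then show "deglt m' k (\<lambda>x. f (\<phi> x) \<noteq> f (\<phi> (x \<oplus> h)))"
      by (subst deglt_cong) (use Suc.prems(4) h in auto)
  qed
qed simp

lemma deglt_translate:
  assumes "deglt m k f" "h \<in> cube m"
  shows "deglt m k (\<lambda>x. f (x \<oplus> h))"
  by (rule deglt_pullback[where l = "\<lambda>h. h", OF assms(1)]) (use assms(2) vadd_right_commute in auto)

text \<open>Product rule: the derivative of f x_i in direction h is (D_h f) x_i + f(x + h) h_i,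
  where h_i is a constant.\<close>

lemma deglt_and_coord:
  assumes "deglt m k f" "i < m"
  shows "deglt m (Suc k) (\<lambda>x. f x \<and> x ! i)"
  using assms(1)
proof (induction k arbitrary: f)
  case (Suc k)
  show ?case
    unfolding deglt.simps(2)[of m "Suc k"]
  proof
    fix h assume h: "h \<in> cube m"
    have 1: "deglt m (Suc k) (\<lambda>x. (f x \<noteq> f (x \<oplus> h)) \<and> x ! i)"
      using Suc.prems h by (intro Suc.IH) simp
    have "deglt m (Suc k) (\<lambda>x. f (x \<oplus> h) \<and> h ! i)"
      using deglt_translate[OF Suc.prems h] by (cases "h ! i") (simp_all del: deglt.simps)
    from deglt_xor[OF 1 this]
    show "deglt m (Suc k) (\<lambda>x. (f x \<and> x ! i) \<noteq> (f (x \<oplus> h) \<and> (x \<oplus> h) ! i))"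
      by (rule deglt_cong[THEN iffD1, rotated]) (use h assms(2) in \<open>auto simp: in_cube\<close>)
  qed
qed simp

lemma deglt_monomial:
  assumes "finite S" "S \<subseteq> {..<m}"
  shows "deglt m (Suc (card S)) (\<lambda>x. \<forall>i\<in>S. x ! i)"
  using assms
proof (induction S)
  case (insert i S)
  then have "deglt m (Suc (Suc (card S))) (\<lambda>x. (\<forall>i\<in>S. x ! i) \<and> x ! i)"
    by (intro deglt_and_coord) auto
  then show ?case
    using insert by (simp del: deglt.simps add: conj_commute)
qed simp

lemma odd_card_insert:
  assumes "finite A" "a \<notin> A"
  shows "odd (card {r \<in> insert a A. P r}) = (P a \<noteq> odd (card {r \<in> A. P r}))"
proof -
  have "{r \<in> insert a A. P r} = (if P a then insert a {r \<in> A. P r} else {r \<in> A. P r})"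
    by auto
  then show ?thesis using assms by auto
qed

lemma deglt_parity:
  assumes "finite A" "\<And>r. r \<in> A \<Longrightarrow> deglt m k (g r)"
  shows "deglt m k (\<lambda>x. odd (card {r \<in> A. g r x}))"
  using assms
proof (induction A)
  case (insert a A)
  then show ?case
    unfolding odd_card_insert[OF insert.hyps] by (intro deglt_xor) blast+
qed simp

text \<open>Monomials are left behind here, because vanishing derivatives are easier to follow
  through affine substitutions. The \<open>Suc d\<close> appears because \<open>deglt\<close> bounds
  the degree strictly.\<close>

lemma deglt_poly:
  assumes "poly_deg_le m d f"
  shows "deglt m (Suc d) f"
proof -
  from assms obtain M where M: "M \<subseteq> {S. S \<subseteq> {..<m} \<and> card S \<le> d}"
    and *: "\<forall>x\<in>cube m. f x = odd (card {S\<in>M. \<forall>i\<in>S. x ! i})"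
    unfolding poly_deg_le_def by (elim exE conjE)
  note f = bspec[OF *]
  have "M \<subseteq> Pow {..<m}" using M by auto
  then have "finite M" by (rule finite_subset) simp
  moreover have "deglt m (Suc d) (\<lambda>x. \<forall>i\<in>S. x ! i)" if "S \<in> M" for S
    using M that by (intro deglt_mono[OF deglt_monomial]) (auto intro: finite_subset)
  ultimately have "deglt m (Suc d) (\<lambda>x. odd (card {S\<in>M. \<forall>i\<in>S. x ! i}))"
    by (rule deglt_parity)
  then show ?thesis
    by (subst deglt_cong[OF f])
qed

text \<open>For \<open>j\<close> directions, the parts of length \<open>m\<close> of \<open>z\<close>, this is the sum of \<open>F\<close> over the
  parallelepiped with base point \<open>x\<close>.\<close>

primrec cub :: "nat \<Rightarrow> nat \<Rightarrow> (bool list \<Rightarrow> bool) \<Rightarrow> bool list \<Rightarrow> bool list \<Rightarrow> bool" where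
  "cub m 0 F x z = F x"
| "cub m (Suc j) F x z = (cub m j F x (drop m z) \<noteq> cub m j F (x \<oplus> take m z) (drop m z))"

lemma cub_xor: "cub m j (\<lambda>x. F x \<noteq> G x) x z = (cub m j F x z \<noteq> cub m j G x z)"
proof (induction j arbitrary: x z)
  case (Suc j)
  show ?case unfolding cub.simps Suc by argo
qed simp

lemma cub_translate: "cub m j (\<lambda>x. F (x \<oplus> h)) x z = cub m j F (x \<oplus> h) z"
proof (induction j arbitrary: x z)
  case (Suc j)
  show ?case unfolding cub.simps Suc by (simp only: vadd_right_commute[of x _ h])
qed simp

text \<open>The sum over a parallelepiped is an iterated derivative: \<open>cub_xor\<close> and
  \<open>cub_translate\<close> move the first direction into the function.\<close>

lemma cub_deglt:
  assumes "deglt m j F" "x \<in> cube m" "z \<in> cube (m * j)"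
  shows "\<not> cub m j F x z"
  using assms
proof (induction j arbitrary: F x z)
  case (Suc j)
  have "take m z \<in> cube m" "drop m z \<in> cube (m * j)"
    using Suc.prems by (auto simp: in_cube)
  then have "\<not> cub m j (\<lambda>x. F x \<noteq> F (x \<oplus> take m z)) x (drop m z)"
    using Suc.prems by (intro Suc.IH) auto
  then show ?case
    unfolding cub.simps cub_xor cub_translate .
qed simp

text \<open>Union bound over the 2^j - 1 vertices other than \<open>x\<close>, each uniformly
  distributed for random directions. One more direction h adds the vertex x + h and a second copy of
  the smaller parallelepiped: 2 (2^j - 1) + 1 = 2^(j+1) - 1.\<close>

lemma ex_cub_le:
  assumes "x \<in> cube m"
  shows "ex (m * j) (\<lambda>z. of_bool (cub m j B x z \<noteq> B x))
    \<le> (2 ^ j - 1) * ex m (\<lambda>x. of_bool (B x))"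
  using assms
proof (induction j arbitrary: x)
  case (Suc j)
  define \<beta> where "\<beta> = ex m (\<lambda>x. of_bool (B x))"
  have "ex (m * Suc j) (\<lambda>z. of_bool (cub m (Suc j) B x z \<noteq> B x))
      = ex m (\<lambda>h. ex (m * j) (\<lambda>z. of_bool (cub m (Suc j) B x (h @ z) \<noteq> B x)))"
    using ex_append[of m "m * j"] by simp
  also have "\<dots> \<le> ex m (\<lambda>h. ex (m * j) (\<lambda>z. of_bool (cub m j B x z \<noteq> B x)
      + of_bool (cub m j B (x \<oplus> h) z \<noteq> B (x \<oplus> h)) + of_bool (B (x \<oplus> h))))"
    by (intro ex_mono) (auto simp: in_cube)
  also have "\<dots> \<le> ex m (\<lambda>h. (2 ^ j - 1) * \<beta> + (2 ^ j - 1) * \<beta> + of_bool (B (x \<oplus> h)))"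
    unfolding \<beta>_def
    by (intro ex_mono, unfold ex_add ex_const, intro add_mono order_refl Suc.IH)
       (use Suc.prems in auto)
  also have "\<dots> = (2 ^ j - 1) * \<beta> + (2 ^ j - 1) * \<beta> + \<beta>"
    unfolding ex_add ex_const \<beta>_def
    using ex_translate'[OF Suc.prems, of "\<lambda>x. of_bool (B x)"] by simp
  also have "\<dots> = (2 ^ Suc j - 1) * \<beta>"
    by (simp add: algebra_simps)
  finally show ?case unfolding \<beta>_def .
qed simp

section \<open>Ultraproducts of polynomials\<close>

text \<open>Zorn's lemma for the reversed order gives a minimal proper filter below
  \<open>sequentially\<close>. Minimality makes it decide every \<open>P\<close>: its meet with
  \<open>P\<close> is either improper or the filter itself.\<close>

lemma ex_ultrafilter_sequentially:
  "\<exists>U::nat filter. U \<noteq> bot \<and> U \<le> sequentially \<and>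
     (\<forall>P. eventually P U \<or> eventually (\<lambda>n. \<not> P n) U)"
proof -
  define A :: "nat filter set" where "A = {F. F \<noteq> bot \<and> F \<le> sequentially}"
  have "\<exists>U\<in>A. \<forall>F\<in>A. F \<le> U \<longrightarrow> F = U"
  proof (rule predicate_Zorn[of A "\<lambda>F G. G \<le> F"])
    show "partial_order_on A (relation_of (\<lambda>F G. G \<le> F) A)"
      by (rule partial_order_on_relation_ofI) auto
  next
    fix C assume C: "C \<in> Chains (relation_of (\<lambda>F G. G \<le> F) A)"
    then have sub: "C \<subseteq> A" and chain: "\<And>F G. F \<in> C \<Longrightarrow> G \<in> C \<Longrightarrow> F \<le> G \<or> G \<le> F"
      by (auto simp: Chains_def relation_of_def)
    show "\<exists>u\<in>A. \<forall>F\<in>C. u \<le> F"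
    proof (cases "C = {}")
      case True
      have "sequentially \<in> A" by (simp add: A_def)
      with True show ?thesis by blast
    next
      case False
      have "eventually P (Inf C) \<longleftrightarrow> (\<exists>F\<in>C. eventually P F)" for P
      proof (rule eventually_Inf_base[OF False])
        show "\<exists>H\<in>C. H \<le> inf F G" if "F \<in> C" "G \<in> C" for F G
          using chain[OF that] that by (auto intro: bexI[of _ F] bexI[of _ G])
      qed
      then have "Inf C \<noteq> bot"
        using sub unfolding trivial_limit_def A_def by blast
      moreover have "Inf C \<le> sequentially"
      proof -
        obtain F where "F \<in> C" using False by blast
        then have "Inf C \<le> F" "F \<le> sequentially"
          using sub by (auto simp: A_def intro: Inf_lower)
        then show ?thesis by (rule order_trans)
      qed
      ultimately show ?thesis
        unfolding A_def by (auto intro!: bexI[of _ "Inf C"] Inf_lower)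
    qed
  qed
  then obtain U where U: "U \<noteq> bot" "U \<le> sequentially"
    and max: "\<And>F. F \<noteq> bot \<Longrightarrow> F \<le> U \<Longrightarrow> F = U"
    unfolding A_def by (auto intro: order_trans)
  have "eventually P U \<or> eventually (\<lambda>n. \<not> P n) U" for P
  proof (rule disjCI)
    assume "\<not> eventually (\<lambda>n. \<not> P n) U"
    then have "inf U (principal {n. P n}) \<noteq> bot"
      by (simp add: trivial_limit_def eventually_inf_principal)
    then have "inf U (principal {n. P n}) = U"
      by (rule max) simp
    moreover have "eventually P (inf U (principal {n. P n}))"
      by (simp add: eventually_inf_principal)
    ultimately show "eventually P U" by simp
  qed
  with U show ?thesis by blast
qed

text \<open>Fourier expansion on F_2^R, a vector being the set of its nonzero coordinates. A new
  coordinate \<open>a\<close> splits \<open>g\<close> into the average and the half-difference over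
  \<open>a\<close>, which give the coefficients of the sets without and with \<open>a\<close>. The
  empty coefficient is the mean, recorded for the arithmetic at the end.\<close>

lemma walsh_expansion:
  fixes g :: "'a set \<Rightarrow> real"
  assumes "finite R"
  shows "\<exists>c. (\<forall>B\<subseteq>R. g B = (\<Sum>C\<in>Pow R. c C * chi (odd (card (B \<inter> C))))) \<and>
    c {} = (\<Sum>B\<in>Pow R. g B) / 2 ^ card R"
  using assms
proof (induction R arbitrary: g)
  case empty
  show ?case by (intro exI[of _ "\<lambda>_. g {}"]) simp
next
  case (insert a R)
  obtain c0 where c0: "\<And>B. B \<subseteq> R \<Longrightarrow>
      (g B + g (insert a B)) / 2 = (\<Sum>C\<in>Pow R. c0 C * chi (odd (card (B \<inter> C))))"
    "c0 {} = (\<Sum>B\<in>Pow R. (g B + g (insert a B)) / 2) / 2 ^ card R"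
    using insert.IH[of "\<lambda>B. (g B + g (insert a B)) / 2"] by blast
  obtain c1 where c1: "\<And>B. B \<subseteq> R \<Longrightarrow>
      (g B - g (insert a B)) / 2 = (\<Sum>C\<in>Pow R. c1 C * chi (odd (card (B \<inter> C))))"
    using insert.IH[of "\<lambda>B. (g B - g (insert a B)) / 2"] by blast
  define c where "c C = (if a \<in> C then c1 (C - {a}) else c0 C)" for C
  have inj: "inj_on (insert a) (Pow R)"
    using insert.hyps by (auto simp: inj_on_def)
  have disj: "Pow R \<inter> insert a ` Pow R = {}"
    using insert.hyps by auto
  have split: "(\<Sum>C\<in>Pow (insert a R). F C) = (\<Sum>C\<in>Pow R. F C) + (\<Sum>C\<in>Pow R. F (insert a C))"
    for F :: "'a set \<Rightarrow> real"
    unfolding Pow_insert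
    by (subst sum.union_disjoint) (use insert.hyps disj in \<open>auto simp: sum.reindex[OF inj]\<close>)
  have c_simps: "c C = c0 C" "c (insert a C) = c1 C" if "C \<subseteq> R" for C
    using that insert.hyps by (auto simp: c_def Diff_insert_absorb subset_iff)
      (metis Diff_empty Diff_insert0 subsetI subsetD)
  have "g B = (\<Sum>C\<in>Pow (insert a R). c C * chi (odd (card (B \<inter> C))))" if B: "B \<subseteq> insert a R" for B
  proof -
    define B' where "B' = B - {a}"
    have B': "B' \<subseteq> R" "a \<notin> B'" using B by (auto simp: B'_def)
    have fin: "finite B'" using B' insert.hyps finite_subset by blast
    have eq: "(\<Sum>C\<in>Pow (insert a R). c C * chi (odd (card (B \<inter> C))))
      = (\<Sum>C\<in>Pow R. c0 C * chi (odd (card (B' \<inter> C))))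
        + chi (a \<in> B) * (\<Sum>C\<in>Pow R. c1 C * chi (odd (card (B' \<inter> C))))"
    proof -
      have "B \<inter> C = B' \<inter> C" if "C \<subseteq> R" for C
        using that insert.hyps by (auto simp: B'_def)
      moreover have "chi (odd (card (B \<inter> insert a C))) = chi (a \<in> B) * chi (odd (card (B' \<inter> C)))"
        if "C \<subseteq> R" for C
      proof (cases "a \<in> B")
        case True
        then have "B \<inter> insert a C = insert a (B' \<inter> C)" by (auto simp: B'_def)
        with True B' fin show ?thesis by (simp add: chi_def)
      next
        case False
        then have "B \<inter> insert a C = B' \<inter> C" by (auto simp: B'_def)
        with False show ?thesis by simp
      qed
      ultimately show ?thesis
        unfolding split sum_distrib_left
        by (intro arg_cong2[of _ _ _ _ "(+)"] sum.cong) (auto simp: c_simps)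
    qed
    have "B = (if a \<in> B then insert a B' else B')"
      by (auto simp: B'_def)
    then show ?thesis
      unfolding eq c0(1)[OF B'(1), symmetric] c1[OF B'(1), symmetric]
      by (cases "a \<in> B") (auto simp: field_simps)
  qed
  moreover have "c {} = (\<Sum>B\<in>Pow (insert a R). g B) / 2 ^ card (insert a R)"
    unfolding split using insert.hyps c0(2)
    by (simp add: c_def sum.distrib flip: sum_divide_distrib)
  ultimately show ?case by blast
qed

section \<open>Sequences of polynomials modulo null sets\<close>

type_synonym fseq = "nat \<Rightarrow> bool list \<Rightarrow> bool"

definition Pol :: "(nat \<Rightarrow> nat) \<Rightarrow> nat \<Rightarrow> fseq set" where
  "Pol M k = {f. \<forall>N. deglt (M N) k (f N)}"

definition comb :: "fseq set \<Rightarrow> fseq" where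
  "comb C N x = odd (card {r \<in> C. r N x})"

text \<open>One more than the largest degree along the sequence, and 0 for the zero sequence;
  meaningful only for members of some \<open>Pol M k\<close>.\<close>

definition sdeg :: "(nat \<Rightarrow> nat) \<Rightarrow> fseq \<Rightarrow> nat" where
  "sdeg M r = (LEAST k. r \<in> Pol M k)"

lemma Pol_mono: "f \<in> Pol M k \<Longrightarrow> k \<le> l \<Longrightarrow> f \<in> Pol M l"
  by (auto simp: Pol_def intro: deglt_mono)

lemma Pol_xor: "f \<in> Pol M k \<Longrightarrow> g \<in> Pol M k \<Longrightarrow> (\<lambda>N x. f N x \<noteq> g N x) \<in> Pol M k"
  unfolding Pol_def using deglt_xor by blast

lemma Pol_comb: "finite C \<Longrightarrow> C \<subseteq> Pol M k \<Longrightarrow> comb C \<in> Pol M k"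
  unfolding Pol_def comb_def by (auto intro!: deglt_parity)

lemma Pol_sdeg: "r \<in> Pol M k \<Longrightarrow> r \<in> Pol M (sdeg M r)"
  unfolding sdeg_def by (rule LeastI)

lemma sdeg_le: "r \<in> Pol M k \<Longrightarrow> sdeg M r \<le> k"
  unfolding sdeg_def by (rule Least_le)

lemma comb_insert:
  assumes "finite C" "r \<notin> C"
  shows "comb (insert r C) N x = (r N x \<noteq> comb C N x)"
  using odd_card_insert[OF assms, of "\<lambda>r. r N x"] by (simp add: comb_def)

text \<open>Combinations are the Walsh characters of the profile \<open>{r \<in> R. r N x}\<close>;
  this links \<open>walsh_expansion\<close> with neutrality of combinations.\<close>

lemma comb_profile:
  assumes "C \<subseteq> R"
  shows "comb C N x = odd (card ({r \<in> R. r N x} \<inter> C))"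
proof -
  have "{r \<in> R. r N x} \<inter> C = {r \<in> C. r N x}" using assms by auto
  then show ?thesis by (simp add: comb_def)
qed

locale ultra =
  fixes U :: "nat filter"
  assumes nontriv: "U \<noteq> bot"
    and le_seq: "U \<le> sequentially"
    and ultra: "eventually P U \<or> eventually (\<lambda>n. \<not> P n) U"
begin

definition null :: "(nat \<Rightarrow> nat) \<Rightarrow> fseq \<Rightarrow> bool" where
  "null M B \<longleftrightarrow> ((\<lambda>N. ex (M N) (\<lambda>x. of_bool (B N x))) \<longlongrightarrow> 0) U"

definition biased :: "(nat \<Rightarrow> nat) \<Rightarrow> fseq \<Rightarrow> bool" where
  "biased M f \<longleftrightarrow> \<not> ((\<lambda>N. ex (M N) (\<lambda>x. chi (f N x))) \<longlongrightarrow> 0) U"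

text \<open>Almost everywhere along \<open>U\<close>, \<open>f\<close> is a function, the same for all \<open>N\<close>, of the values of the
  members of \<open>A\<close>.\<close>

definition alg :: "(nat \<Rightarrow> nat) \<Rightarrow> fseq set \<Rightarrow> fseq \<Rightarrow> bool" where
  "alg M A f \<longleftrightarrow> (\<exists>\<Gamma>. null M (\<lambda>N x. f N x \<noteq> \<Gamma> {r \<in> A. r N x}))"

text \<open>\<open>U\<close> decides every property, so failure of convergence is a lower bound for
  \<open>U\<close>-most \<open>N\<close>, and not merely for infinitely many.\<close>

lemma not_tendsto_0D:
  fixes b :: "nat \<Rightarrow> real"
  assumes "\<not> (b \<longlongrightarrow> 0) U"
  shows "\<exists>\<kappa>>0. eventually (\<lambda>N. \<kappa> \<le> \<bar>b N\<bar>) U"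
proof -
  from assms obtain \<kappa> where "\<kappa> > 0" "\<not> eventually (\<lambda>N. \<bar>b N\<bar> < \<kappa>) U"
    by (auto simp: tendsto_iff)
  then show ?thesis
    using ultra[of "\<lambda>N. \<bar>b N\<bar> < \<kappa>"] by (auto simp: not_less)
qed

lemma null_mono:
  assumes "null M B" "\<And>N x. x \<in> cube (M N) \<Longrightarrow> B' N x \<Longrightarrow> B N x"
  shows "null M B'"
  unfolding null_def
proof (rule tendsto_sandwich[OF _ _ tendsto_const assms(1)[unfolded null_def]])
  show "\<forall>\<^sub>F N in U. 0 \<le> ex (M N) (\<lambda>x. of_bool (B' N x))"
    by (intro always_eventually allI ex_nonneg) simp
  show "\<forall>\<^sub>F N in U. ex (M N) (\<lambda>x. of_bool (B' N x)) \<le> ex (M N) (\<lambda>x. of_bool (B N x))"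
    using assms(2) by (intro always_eventually allI ex_mono) auto
qed

lemma null_bound:
  assumes "(e \<longlongrightarrow> 0) U" "\<forall>\<^sub>F N in U. ex (M N) (\<lambda>x. of_bool (B N x)) \<le> e N"
  shows "null M B"
  unfolding null_def
  by (rule tendsto_sandwich[OF _ _ tendsto_const assms(1)])
     (auto intro!: always_eventually[of "\<lambda>N. 0 \<le> F N" for F] ex_nonneg assms(2))

lemma null_False: "null M (\<lambda>N x. False)"
  by (simp add: null_def)

lemma null_disj:
  assumes "null M A" "null M B"
  shows "null M (\<lambda>N x. A N x \<or> B N x)"
proof (rule null_bound)
  show "((\<lambda>N. ex (M N) (\<lambda>x. of_bool (A N x)) + ex (M N) (\<lambda>x. of_bool (B N x))) \<longlongrightarrow> 0) U"
    using tendsto_add[OF assms[unfolded null_def]] by simp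
  show "\<forall>\<^sub>F N in U. ex (M N) (\<lambda>x. of_bool (A N x \<or> B N x))
      \<le> ex (M N) (\<lambda>x. of_bool (A N x)) + ex (M N) (\<lambda>x. of_bool (B N x))"
    unfolding ex_add[symmetric] by (intro always_eventually allI ex_mono) auto
qed

lemma null_Bex:
  assumes "finite I" "\<And>i. i \<in> I \<Longrightarrow> null M (B i)"
  shows "null M (\<lambda>N x. \<exists>i\<in>I. B i N x)"
  using assms
proof (induction I)
  case (insert i I)
  have "null M (\<lambda>N x. B i N x \<or> (\<exists>i\<in>I. B i N x))"
    using insert by (intro null_disj) auto
  then show ?case by (rule null_mono) auto
qed (simp add: null_False)

lemma alg_trans:
  assumes f: "alg M A f" and A: "finite A" "\<And>r. r \<in> A \<Longrightarrow> alg M B r"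
  shows "alg M B f"
proof -
  obtain \<Gamma> where \<Gamma>: "null M (\<lambda>N x. f N x \<noteq> \<Gamma> {r \<in> A. r N x})"
    using f by (auto simp: alg_def)
  obtain D where D: "\<And>r. r \<in> A \<Longrightarrow> null M (\<lambda>N x. r N x \<noteq> D r {s \<in> B. s N x})"
    using bchoice[of A "\<lambda>r \<Delta>. null M (\<lambda>N x. r N x \<noteq> \<Delta> {s \<in> B. s N x})"] A(2)
    unfolding alg_def by blast
  have "null M (\<lambda>N x. f N x \<noteq> \<Gamma> {r \<in> A. r N x} \<or> (\<exists>r\<in>A. r N x \<noteq> D r {s \<in> B. s N x}))"
    by (intro null_disj null_Bex \<Gamma> A(1) D)
  then have "null M (\<lambda>N x. f N x \<noteq> \<Gamma> {r \<in> A. D r {s \<in> B. s N x}})"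
  proof (rule null_mono)
    fix N x
    assume *: "f N x \<noteq> \<Gamma> {r \<in> A. D r {s \<in> B. s N x}}"
    show "f N x \<noteq> \<Gamma> {r \<in> A. r N x} \<or> (\<exists>r\<in>A. r N x \<noteq> D r {s \<in> B. s N x})"
    proof (rule ccontr)
      assume "\<not> ?thesis"
      then have "{r \<in> A. r N x} = {r \<in> A. D r {s \<in> B. s N x}}" "f N x = \<Gamma> {r \<in> A. r N x}"
        by auto
      with * show False by simp
    qed
  qed
  then show ?thesis
    unfolding alg_def by (intro exI[of _ "\<lambda>S. \<Gamma> {r \<in> A. D r S}"])
qed

lemma alg_exact: "(\<And>N x. x \<in> cube (M N) \<Longrightarrow> f N x = \<Gamma> {r \<in> A. r N x}) \<Longrightarrow> alg M A f"
  unfolding alg_def by (rule exI[of _ \<Gamma>], rule null_mono[OF null_False]) simp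

lemma alg_mem: "r \<in> A \<Longrightarrow> alg M A r"
  by (rule alg_exact[where \<Gamma> = "\<lambda>S. r \<in> S"]) simp

lemma alg_mono:
  assumes "alg M A f" "A \<subseteq> B"
  shows "alg M B f"
proof -
  obtain \<Gamma> where \<Gamma>: "null M (\<lambda>N x. f N x \<noteq> \<Gamma> {r \<in> A. r N x})"
    using assms(1) by (auto simp: alg_def)
  have "{r \<in> B. r N x} \<inter> A = {r \<in> A. r N x}" for N x
    using assms(2) by auto
  with \<Gamma> show ?thesis
    unfolding alg_def by (intro exI[of _ "\<lambda>S. \<Gamma> (S \<inter> A)"]) simp
qed

lemma alg_xor:
  assumes "alg M A f" "alg M A g"
  shows "alg M A (\<lambda>N x. f N x \<noteq> g N x)"
proof -
  have "alg M {f, g} (\<lambda>N x. f N x \<noteq> g N x)"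
    by (rule alg_exact[where \<Gamma> = "\<lambda>S. (f \<in> S) \<noteq> (g \<in> S)"]) simp
  then show ?thesis
    by (rule alg_trans) (use assms in auto)
qed

lemma alg_comb: "finite C \<Longrightarrow> C \<subseteq> A \<Longrightarrow> alg M A (comb C)"
  by (rule alg_exact[where \<Gamma> = "\<lambda>S. odd (card (S \<inter> C))"]) (rule comb_profile)

text \<open>A combination of \<open>R1 \<sigma>\<close> that is not neutral differs from some \<open>q0\<close> in \<open>Q0\<close> by a biased
  polynomial, which the structure hypothesis expresses through polynomials of lower degree.
  Trading a member of maximal degree for these decreases the multiset of degrees.\<close>

lemma regularization:
  fixes L :: "'i set \<Rightarrow> bool" and neut :: "fseq set \<Rightarrow> fseq \<Rightarrow> bool" and K :: nat
  assumes large: "\<And>\<Sigma> (c :: 'i \<Rightarrow> nat). L \<Sigma> \<Longrightarrow> \<exists>n. L {\<sigma>\<in>\<Sigma>. c \<sigma> = n}"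
    and large_ne: "\<not> L {}"
    and biased_struct: "\<And>k f. k \<le> K \<Longrightarrow> f \<in> Pol M k \<Longrightarrow> biased M f \<Longrightarrow>
      \<exists>T. finite T \<and> T \<subseteq> (\<Union>j<k. Pol M j) \<and> alg M T f"
    and step: "\<And>\<Sigma> k R0 q. L \<Sigma> \<Longrightarrow> k \<le> K \<Longrightarrow> finite R0 \<Longrightarrow> R0 \<subseteq> Q0 \<Longrightarrow>
      (\<And>\<sigma>. \<sigma> \<in> \<Sigma> \<Longrightarrow> q \<sigma> \<in> Pol M k \<and> \<not> neut R0 (q \<sigma>)) \<Longrightarrow>
      \<exists>\<Sigma>'\<subseteq>\<Sigma>. L \<Sigma>' \<and> (\<exists>q0\<in>Q0 \<inter> Pol M k. \<forall>\<sigma>\<in>\<Sigma>'. biased M (\<lambda>N x. q \<sigma> N x \<noteq> q0 N x))"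
    and "L \<Sigma>" "finite R0" "R0 \<subseteq> Q0"
    and "\<forall>\<sigma>\<in>\<Sigma>. finite (R1 \<sigma>) \<and> R1 \<sigma> \<subseteq> Pol M K \<and>
      image_mset (sdeg M) (mset_set (R1 \<sigma>)) = D"
  shows "\<exists>\<Sigma>'\<subseteq>\<Sigma>. L \<Sigma>' \<and> (\<exists>R0' R1'. finite R0' \<and> R0 \<subseteq> R0' \<and> R0' \<subseteq> Q0 \<and>
    (\<forall>\<sigma>\<in>\<Sigma>'. finite (R1' \<sigma>) \<and> (\<forall>r\<in>R1 \<sigma>. alg M (R0' \<union> R1' \<sigma>) r) \<and>
      (\<forall>C\<subseteq>R1' \<sigma>. C \<noteq> {} \<longrightarrow> neut R0' (comb C))))"
  using assms(5-8)
proof (induction D arbitrary: \<Sigma> R0 R1 rule: less_induct)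
  case (less D)
  note R1 = less.prems(4)[rule_format]
  define good where "good \<sigma> \<longleftrightarrow> (\<forall>C\<subseteq>R1 \<sigma>. C \<noteq> {} \<longrightarrow> neut R0 (comb C))" for \<sigma>
  define C where "C \<sigma> = (SOME C. C \<subseteq> R1 \<sigma> \<and> C \<noteq> {} \<and> \<not> neut R0 (comb C))" for \<sigma>
  have C: "C \<sigma> \<subseteq> R1 \<sigma> \<and> C \<sigma> \<noteq> {} \<and> \<not> neut R0 (comb (C \<sigma>))" if "\<not> good \<sigma>" for \<sigma>
    unfolding C_def by (rule someI_ex) (use that in \<open>auto simp: good_def\<close>)
  define mx where "mx \<sigma> = Max (sdeg M ` C \<sigma>)" for \<sigma>
  \<comment> \<open>Colour 0 marks the indices that are finished, colour \<open>Suc k\<close> those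
    whose offending combination has maximal degree \<open>k\<close>. The notion \<open>L\<close> of
    largeness is nonemptiness or uncountability in the two applications, and one colour class
    remains large.\<close>
  obtain n where n: "L {\<sigma>\<in>\<Sigma>. (if good \<sigma> then 0 else Suc (mx \<sigma>)) = n}"
    using large[OF less.prems(1), of "\<lambda>\<sigma>. if good \<sigma> then 0 else Suc (mx \<sigma>)"] by blast
  show ?case
  proof (cases n)
    case 0
    then have "{\<sigma>\<in>\<Sigma>. (if good \<sigma> then 0 else Suc (mx \<sigma>)) = n} = {\<sigma>\<in>\<Sigma>. good \<sigma>}"
      by auto
    with n have "L {\<sigma>\<in>\<Sigma>. good \<sigma>}" by simp
    then show ?thesis
      using less.prems
      by (intro exI[of _ "{\<sigma>\<in>\<Sigma>. good \<sigma>}"] conjI exI[of _ R0] exI[of _ R1])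
         (auto simp: good_def intro!: alg_mem)
  next
    case (Suc k)
    define \<Sigma>1 where "\<Sigma>1 = {\<sigma>\<in>\<Sigma>. \<not> good \<sigma> \<and> mx \<sigma> = k}"
    have "{\<sigma>\<in>\<Sigma>. (if good \<sigma> then 0 else Suc (mx \<sigma>)) = n} = \<Sigma>1"
      by (auto simp: \<Sigma>1_def Suc)
    with n have L1: "L \<Sigma>1" by simp
    have fin: "finite (C \<sigma>)" if "\<sigma> \<in> \<Sigma>1" for \<sigma>
      using that C R1 by (metis (mono_tags, lifting) \<Sigma>1_def finite_subset mem_Collect_eq)
    have sub: "C \<sigma> \<subseteq> Pol M k" if \<sigma>: "\<sigma> \<in> \<Sigma>1" for \<sigma>
    proof
      fix r assume r: "r \<in> C \<sigma>"
      then have "r \<in> Pol M K" using C[of \<sigma>] R1[of \<sigma>] \<sigma> by (auto simp: \<Sigma>1_def)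
      moreover have "sdeg M r \<le> k"
        using Max_ge[of "sdeg M ` C \<sigma>" "sdeg M r"] r fin[OF \<sigma>] \<sigma> by (auto simp: \<Sigma>1_def mx_def)
      ultimately show "r \<in> Pol M k" by (metis Pol_sdeg Pol_mono)
    qed
    have ex_r: "\<exists>r\<in>C \<sigma>. sdeg M r = k" if \<sigma>: "\<sigma> \<in> \<Sigma>1" for \<sigma>
    proof -
      have "Max (sdeg M ` C \<sigma>) \<in> sdeg M ` C \<sigma>"
        using C[of \<sigma>] fin[OF \<sigma>] \<sigma> by (intro Max_in) (auto simp: \<Sigma>1_def)
      then show ?thesis using \<sigma> by (auto simp: \<Sigma>1_def mx_def)
    qed
    then obtain r where r: "\<And>\<sigma>. \<sigma> \<in> \<Sigma>1 \<Longrightarrow> r \<sigma> \<in> C \<sigma> \<and> sdeg M (r \<sigma>) = k"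
      by metis
    have rR: "r \<sigma> \<in> R1 \<sigma>" if "\<sigma> \<in> \<Sigma>1" for \<sigma>
      using r[OF that] C[of \<sigma>] that by (auto simp: \<Sigma>1_def)
    have "k \<le> K"
    proof -
      obtain \<sigma> where \<sigma>: "\<sigma> \<in> \<Sigma>1" using L1 large_ne by fastforce
      then have "r \<sigma> \<in> Pol M K" using rR[OF \<sigma>] R1[of \<sigma>] by (auto simp: \<Sigma>1_def)
      then show ?thesis using sdeg_le r[OF \<sigma>] by blast
    qed
    have "comb (C \<sigma>) \<in> Pol M k \<and> \<not> neut R0 (comb (C \<sigma>))" if "\<sigma> \<in> \<Sigma>1" for \<sigma>
      using Pol_comb[OF fin sub, OF that that] C that by (auto simp: \<Sigma>1_def)
    then obtain \<Sigma>2 q0 where \<Sigma>2: "\<Sigma>2 \<subseteq> \<Sigma>1" "L \<Sigma>2" and q0: "q0 \<in> Q0" "q0 \<in> Pol M k"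
      and bias: "\<And>\<sigma>. \<sigma> \<in> \<Sigma>2 \<Longrightarrow> biased M (\<lambda>N x. comb (C \<sigma>) N x \<noteq> q0 N x)"
      using step[OF L1 \<open>k \<le> K\<close> less.prems(2,3), of "\<lambda>\<sigma>. comb (C \<sigma>)"] by blast
    define u where "u \<sigma> = (\<lambda>N x. comb (C \<sigma>) N x \<noteq> q0 N x)" for \<sigma>
    have "\<exists>T. finite T \<and> T \<subseteq> (\<Union>j<k. Pol M j) \<and> alg M T (u \<sigma>)" if \<sigma>: "\<sigma> \<in> \<Sigma>2" for \<sigma>
      unfolding u_def using \<sigma> \<Sigma>2 bias q0
      by (intro biased_struct[OF \<open>k \<le> K\<close>] Pol_xor Pol_comb fin sub) auto
    then obtain T where T: "\<And>\<sigma>. \<sigma> \<in> \<Sigma>2 \<Longrightarrow>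
        finite (T \<sigma>) \<and> T \<sigma> \<subseteq> (\<Union>j<k. Pol M j) \<and> alg M (T \<sigma>) (u \<sigma>)"
      by metis
    define R2 where "R2 \<sigma> = (R1 \<sigma> - {r \<sigma>}) \<union> T \<sigma>" for \<sigma>
    define D2 where "D2 \<sigma> = image_mset (sdeg M) (mset_set (R2 \<sigma>))" for \<sigma>
    \<comment> \<open>The new multiset of degrees may depend on \<sigma>. Multisets of numbers are
      countably many, so a large set of indices shares one, as the induction requires.\<close>
    obtain n' where n': "L {\<sigma>\<in>\<Sigma>2. to_nat (sorted_list_of_multiset (D2 \<sigma>)) = n'}"
      using large[OF \<Sigma>2(2), of "\<lambda>\<sigma>. to_nat (sorted_list_of_multiset (D2 \<sigma>))"] by blast
    define \<Sigma>3 where "\<Sigma>3 = {\<sigma>\<in>\<Sigma>2. to_nat (sorted_list_of_multiset (D2 \<sigma>)) = n'}"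
    have L3: "L \<Sigma>3" using n' by (simp add: \<Sigma>3_def)
    then obtain \<sigma>0 where \<sigma>0: "\<sigma>0 \<in> \<Sigma>3" using large_ne by fastforce
    have D2: "D2 \<sigma> = D2 \<sigma>0" if "\<sigma> \<in> \<Sigma>3" for \<sigma>
    proof -
      have "to_nat (sorted_list_of_multiset (D2 \<sigma>)) = to_nat (sorted_list_of_multiset (D2 \<sigma>0))"
        using that \<sigma>0 by (simp add: \<Sigma>3_def)
      then have "sorted_list_of_multiset (D2 \<sigma>) = sorted_list_of_multiset (D2 \<sigma>0)"
        by (rule injD[OF inj_to_nat])
      then show ?thesis by (metis mset_sorted_list_of_multiset)
    qed
    have sub3: "\<Sigma>3 \<subseteq> \<Sigma>2" "\<Sigma>3 \<subseteq> \<Sigma>1" "\<Sigma>3 \<subseteq> \<Sigma>"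
      using \<Sigma>2 by (auto simp: \<Sigma>3_def \<Sigma>1_def)
    have less_D: "D2 \<sigma>0 < D"
    proof -
      \<comment> \<open>\<open>?B\<close> omits what already survives in \<open>?A\<close>, so the
        union is disjoint: the new multiset is \<open>D\<close> with one entry \<open>k\<close>
        replaced by entries below \<open>k\<close>.\<close>
      let ?A = "R1 \<sigma>0 - {r \<sigma>0}" and ?B = "T \<sigma>0 - (R1 \<sigma>0 - {r \<sigma>0})"
      have fin0: "finite (R1 \<sigma>0)" "finite (T \<sigma>0)"
        using R1 T \<sigma>0 sub3 by blast+
      have "R2 \<sigma>0 = ?A \<union> ?B" by (auto simp: R2_def)
      then have "mset_set (R2 \<sigma>0) = mset_set ?A + mset_set ?B"
        using fin0 by (simp add: mset_set_Union del: Un_Diff_cancel)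
      then have D2_eq: "D2 \<sigma>0 = image_mset (sdeg M) (mset_set ?A) + image_mset (sdeg M) (mset_set ?B)"
        by (simp add: D2_def)
      have "insert (r \<sigma>0) ?A = R1 \<sigma>0" using rR \<sigma>0 sub3 by auto
      then have "mset_set (R1 \<sigma>0) = add_mset (r \<sigma>0) (mset_set ?A)"
        using mset_set.insert[of ?A "r \<sigma>0"] fin0 by simp
      then have D_eq: "D = image_mset (sdeg M) (mset_set ?A) + {#k#}"
        using R1[of \<sigma>0] r[of \<sigma>0] \<sigma>0 sub3 by auto
      have "image_mset (sdeg M) (mset_set ?B) < {#k#}"
      proof (rule ex_gt_imp_less_multiset, intro exI[of _ k] conjI allI impI)
        fix j assume "j \<in># image_mset (sdeg M) (mset_set ?B)"
        then obtain t where t: "t \<in> T \<sigma>0" "j = sdeg M t" using fin0 by auto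
        then obtain i where "i < k" "t \<in> Pol M i" using T[of \<sigma>0] \<sigma>0 sub3 by blast
        then show "j < k" using sdeg_le[of t M i] t by simp
      qed simp
      then show ?thesis
        unfolding D2_eq D_eq by (rule add_strict_left_mono)
    qed
    have R2: "finite (R2 \<sigma>) \<and> R2 \<sigma> \<subseteq> Pol M K \<and> image_mset (sdeg M) (mset_set (R2 \<sigma>)) = D2 \<sigma>0"
      if \<sigma>: "\<sigma> \<in> \<Sigma>3" for \<sigma>
    proof (intro conjI)
      show "finite (R2 \<sigma>)" using R1 T \<sigma> sub3 unfolding R2_def by blast
      have "T \<sigma> \<subseteq> Pol M K"
      proof
        fix t assume "t \<in> T \<sigma>"
        then obtain i where "i < k" "t \<in> Pol M i" using T[of \<sigma>] \<sigma> sub3 by blast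
        then show "t \<in> Pol M K" using \<open>k \<le> K\<close> by (intro Pol_mono[of t M i K]) auto
      qed
      then show "R2 \<sigma> \<subseteq> Pol M K"
        using R1[of \<sigma>] \<sigma> sub3 by (auto simp: R2_def)
      show "image_mset (sdeg M) (mset_set (R2 \<sigma>)) = D2 \<sigma>0"
        using D2[OF \<sigma>] by (simp add: D2_def)
    qed
    have "insert q0 R0 \<subseteq> Q0" "finite (insert q0 R0)"
      using less.prems(2,3) q0(1) by auto
    moreover have "\<forall>\<sigma>\<in>\<Sigma>3. finite (R2 \<sigma>) \<and> R2 \<sigma> \<subseteq> Pol M K \<and>
        image_mset (sdeg M) (mset_set (R2 \<sigma>)) = D2 \<sigma>0"
      using R2 by (rule ballI)
    ultimately have "\<exists>\<Sigma>'\<subseteq>\<Sigma>3. L \<Sigma>' \<and> (\<exists>R0' R1'. finite R0' \<and> insert q0 R0 \<subseteq> R0' \<and> R0' \<subseteq> Q0 \<and>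
        (\<forall>\<sigma>\<in>\<Sigma>'. finite (R1' \<sigma>) \<and> (\<forall>r\<in>R2 \<sigma>. alg M (R0' \<union> R1' \<sigma>) r) \<and>
          (\<forall>C\<subseteq>R1' \<sigma>. C \<noteq> {} \<longrightarrow> neut R0' (comb C))))"
      by (intro less.IH[OF less_D L3])
    then
    obtain \<Sigma>' R0' R1' where *: "\<Sigma>' \<subseteq> \<Sigma>3" "L \<Sigma>'" "finite R0'" "insert q0 R0 \<subseteq> R0'" "R0' \<subseteq> Q0"
      and R1': "\<forall>\<sigma>\<in>\<Sigma>'. finite (R1' \<sigma>) \<and> (\<forall>r\<in>R2 \<sigma>. alg M (R0' \<union> R1' \<sigma>) r) \<and>
        (\<forall>C\<subseteq>R1' \<sigma>. C \<noteq> {} \<longrightarrow> neut R0' (comb C))"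
      by (elim exE conjE) (rule that)
    note ** = bspec[OF R1']
    have "alg M (R0' \<union> R1' \<sigma>) s" if \<sigma>: "\<sigma> \<in> \<Sigma>'" and s: "s \<in> R1 \<sigma>" for \<sigma> s
    proof (cases "s = r \<sigma>")
      case False
      then have "s \<in> R2 \<sigma>" using s by (simp add: R2_def)
      then show ?thesis using **[OF \<sigma>] by blast
    next
      case True
      have \<sigma>2: "\<sigma> \<in> \<Sigma>2" "\<sigma> \<in> \<Sigma>1" using \<sigma> * sub3 by auto
      let ?B = "R0' \<union> R1' \<sigma>"
      let ?C = "C \<sigma> - {r \<sigma>}"
      have C1: "alg M ?B (comb ?C)"
      proof (rule alg_trans)
        show "alg M ?C (comb ?C)" using fin \<sigma>2 by (intro alg_comb) auto
        show "finite ?C" using fin \<sigma>2 by auto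
        show "alg M ?B r'" if "r' \<in> ?C" for r'
          using **[OF \<sigma>] that C[of \<sigma>] \<sigma>2 by (auto simp: R2_def \<Sigma>1_def)
      qed
      have C2: "alg M ?B (u \<sigma>)"
        by (rule alg_trans[of _ "T \<sigma>"]) (use T[OF \<sigma>2(1)] **[OF \<sigma>] in \<open>auto simp: R2_def\<close>)
      have C3: "alg M ?B q0" using * by (intro alg_mem) auto
      \<comment> \<open>The discarded polynomial is recovered as the biased sum
        \<open>u \<sigma>\<close> plus \<open>q0\<close> plus the rest of its combination.\<close>
      have "comb (C \<sigma>) N x = (r \<sigma> N x \<noteq> comb ?C N x)" for N x
        using comb_insert[of ?C "r \<sigma>" N x] fin[OF \<sigma>2(2)] r[OF \<sigma>2(2)] by (simp add: insert_absorb)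
      then have "s = (\<lambda>N x. (u \<sigma> N x \<noteq> q0 N x) \<noteq> comb ?C N x)"
        using True by (intro ext) (auto simp: u_def)
      then show ?thesis
        using alg_xor[OF alg_xor[OF C2 C3] C1] by simp
    qed
    then have "\<forall>\<sigma>\<in>\<Sigma>'. finite (R1' \<sigma>) \<and> (\<forall>r\<in>R1 \<sigma>. alg M (R0' \<union> R1' \<sigma>) r) \<and>
        (\<forall>C\<subseteq>R1' \<sigma>. C \<noteq> {} \<longrightarrow> neut R0' (comb C))"
      using R1' by simp
    moreover have "\<Sigma>' \<subseteq> \<Sigma>" "R0 \<subseteq> R0'" using * sub3 by auto
    ultimately show ?thesis
      using *(2,3,5) by (intro exI[of _ \<Sigma>'] conjI exI[of _ R0'] exI[of _ R1'])
  qed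
qed

end

section \<open>Majority votes of derivatives\<close>

lemma vadd_replicate_False: "length x = n \<Longrightarrow> x \<oplus> replicate n False = x"
  by (auto intro!: nth_equalityI)

text \<open>For random directions and fixed x the signs of f(x + h_j) are independent with mean
  \<open>b\<close>, so the centred sum has variance at most \<open>s\<close>. The directions are
  fixed one at a time, each no worse than average; the cross term with a new direction averages to
  0.\<close>

lemma sampled_translates:
  fixes m :: nat and f :: "bool list \<Rightarrow> bool"
  defines "b \<equiv> ex m (\<lambda>x. chi (f x))"
  shows "\<exists>hs. (\<forall>j. hs j \<in> cube m) \<and>
    ex m (\<lambda>x. (\<Sum>j<s. chi (f (x \<oplus> hs j)) - b)\<^sup>2) \<le> real s"
proof (induction s)
  case 0
  show ?case by (intro exI[of _ "\<lambda>_. replicate m False"]) auto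
next
  case (Suc s)
  then obtain hs where hs: "\<And>j. hs j \<in> cube m"
    and le: "ex m (\<lambda>x. (\<Sum>j<s. chi (f (x \<oplus> hs j)) - b)\<^sup>2) \<le> real s" by blast
  define S where "S x = (\<Sum>j<s. chi (f (x \<oplus> hs j)) - b)" for x
  define e where "e = (\<lambda>x h. chi (f (x \<oplus> h)) - b)"
  have mean_e: "ex m (e x) = 0" if "x \<in> cube m" for x
    using ex_translate'[OF that, of "\<lambda>x. chi (f x)"] by (simp add: e_def ex_diff b_def)
  have mean_e2: "ex m (\<lambda>h. (e x h)\<^sup>2) \<le> 1" if "x \<in> cube m" for x
  proof -
    have "ex m (\<lambda>h. (e x h)\<^sup>2) = ex m (\<lambda>h. 1 + b\<^sup>2 - 2 * b * chi (f (x \<oplus> h)))"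
      by (intro ex_cong) (simp add: e_def power2_eq_square algebra_simps)
    also have "\<dots> = 1 - b\<^sup>2"
      unfolding ex_add ex_diff ex_cmult ex_const
      using ex_translate'[OF that, of "\<lambda>x. chi (f x)"] by (simp add: b_def power2_eq_square)
    finally show ?thesis by simp
  qed
  have "ex m (\<lambda>h. ex m (\<lambda>x. (S x + e x h)\<^sup>2)) = ex m (\<lambda>x. ex m (\<lambda>h. (S x + e x h)\<^sup>2))"
    by (rule ex_swap)
  also have "\<dots> = ex m (\<lambda>x. ex m (\<lambda>h. (S x)\<^sup>2 + 2 * S x * e x h + (e x h)\<^sup>2))"
    by (intro ex_cong) (simp add: power2_eq_square algebra_simps)
  also have "\<dots> \<le> ex m (\<lambda>x. (S x)\<^sup>2 + 1)"
  proof (rule ex_mono)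
    fix x assume x: "x \<in> cube m"
    have "ex m (\<lambda>h. (S x)\<^sup>2 + 2 * S x * e x h + (e x h)\<^sup>2)
        = (S x)\<^sup>2 + 2 * S x * ex m (e x) + ex m (\<lambda>h. (e x h)\<^sup>2)"
      unfolding ex_add ex_cmult ex_const ..
    then show "ex m (\<lambda>h. (S x)\<^sup>2 + 2 * S x * e x h + (e x h)\<^sup>2) \<le> (S x)\<^sup>2 + 1"
      using mean_e[OF x] mean_e2[OF x] by simp
  qed
  also have "\<dots> \<le> real (Suc s)"
    using le by (simp add: ex_add S_def)
  finally have "ex m (\<lambda>h. ex m (\<lambda>x. (S x + e x h)\<^sup>2)) \<le> real (Suc s)" .
  then obtain h where h: "h \<in> cube m" "ex m (\<lambda>x. (S x + e x h)\<^sup>2) \<le> real (Suc s)"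
    using ex_ge_attained[of m "\<lambda>h. ex m (\<lambda>x. (S x + e x h)\<^sup>2)"] by force
  have "(\<Sum>j<Suc s. chi (f (x \<oplus> (hs(s := h)) j)) - b) = S x + e x h" for x
    unfolding S_def e_def by (simp only: sum.lessThan_Suc) (auto intro: sum.cong)
  with h hs show ?case
    by (intro exI[of _ "hs(s := h)"]) auto
qed

text \<open>Chebyshev's inequality: the sum of the derivative signs is \<open>chi (f x)\<close>
  times a sum with mean \<open>real s * b\<close>. A wrong vote forces the deviation
  \<open>S x\<close> to be at least \<open>real s * \<kappa>\<close> in absolute value.\<close>

lemma derivative_vote:
  fixes m :: nat and f :: "bool list \<Rightarrow> bool"
  defines "b \<equiv> ex m (\<lambda>x. chi (f x))"
  assumes "\<bar>sg\<bar> = 1" "\<kappa> \<le> sg * b" "0 < \<kappa>" "0 < s"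
    and le: "ex m (\<lambda>x. (\<Sum>j<s. chi (f (x \<oplus> hs j)) - b)\<^sup>2) \<le> real s"
  shows "ex m (\<lambda>x. of_bool ((sg * (\<Sum>j<s. chi (f x \<noteq> f (x \<oplus> hs j))) < 0) \<noteq> f x))
    \<le> 1 / (real s * \<kappa>\<^sup>2)"
proof -
  define S where "S x = (\<Sum>j<s. chi (f (x \<oplus> hs j)) - b)" for x
  define V where "V x = (\<Sum>j<s. chi (f x \<noteq> f (x \<oplus> hs j)))" for x
  have V: "V x = chi (f x) * (S x + real s * b)" for x
    unfolding V_def S_def chi_neq sum_subtractf by (simp add: sum_distrib_left)
  have "of_bool ((sg * V x < 0) \<noteq> f x) \<le> (S x)\<^sup>2 * (1 / (real s * \<kappa>)\<^sup>2)" for x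
  proof (cases "(sg * V x < 0) = f x")
    case True
    then show ?thesis by simp
  next
    case False
    then have "sg * (S x + real s * b) \<le> 0"
      by (cases "f x") (auto simp: V not_less algebra_simps)
    then have "sg * S x \<le> - (real s * (sg * b))"
      by (simp add: algebra_simps)
    moreover have "real s * \<kappa> \<le> real s * (sg * b)"
      using assms by (intro mult_left_mono) auto
    ultimately have "real s * \<kappa> \<le> \<bar>sg * S x\<bar>" by linarith
    then have "real s * \<kappa> \<le> \<bar>S x\<bar>"
      using assms(2) by (simp add: abs_mult)
    then have "(real s * \<kappa>)\<^sup>2 \<le> (S x)\<^sup>2"
      using power_mono[of "real s * \<kappa>" "\<bar>S x\<bar>" 2] assms(4) by simp
    moreover have "0 < (real s * \<kappa>)\<^sup>2" using assms by simp
    ultimately show ?thesis using False by (simp add: field_simps)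
  qed
  then have "ex m (\<lambda>x. of_bool ((sg * V x < 0) \<noteq> f x)) \<le> ex m (\<lambda>x. (S x)\<^sup>2) * (1 / (real s * \<kappa>)\<^sup>2)"
    by (subst ex_multc[symmetric]) (intro ex_mono)
  also have "\<dots> \<le> real s * (1 / (real s * \<kappa>)\<^sup>2)"
    using le by (intro mult_right_mono) (auto simp: S_def)
  also have "\<dots> = 1 / (real s * \<kappa>\<^sup>2)"
    using assms by (simp add: power2_eq_square field_simps)
  finally show ?thesis by (simp add: V_def)
qed

text \<open>Expanding in \<open>R1\<close> with the profile on \<open>R0\<close> as a parameter
  separates what \<open>R0\<close> decides from the characters that regularization makes neutral.
  The empty coefficient is a mean with denominator \<open>2 ^ card R1\<close>.\<close>

lemma walsh_profile:
  fixes \<Gamma> :: "fseq set \<Rightarrow> bool"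
  assumes "finite R1"
  obtains c where
    "\<And>N x. chi (\<Gamma> {r \<in> R0 \<union> R1. r N x}) = (\<Sum>C\<in>Pow R1. c {r \<in> R0. r N x} C * chi (comb C N x))"
    "\<And>a. c a {} = (\<Sum>B\<in>Pow R1. chi (\<Gamma> (a \<union> B))) / 2 ^ card R1"
proof -
  have "\<exists>c. \<forall>a. (\<forall>B\<subseteq>R1. chi (\<Gamma> (a \<union> B)) = (\<Sum>C\<in>Pow R1. c a C * chi (odd (card (B \<inter> C))))) \<and>
      c a {} = (\<Sum>B\<in>Pow R1. chi (\<Gamma> (a \<union> B))) / 2 ^ card R1"
    by (intro choice allI walsh_expansion assms)
  then obtain c where c: "\<And>a B. B \<subseteq> R1 \<Longrightarrow>
      chi (\<Gamma> (a \<union> B)) = (\<Sum>C\<in>Pow R1. c a C * chi (odd (card (B \<inter> C))))"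
    "\<And>a. c a {} = (\<Sum>B\<in>Pow R1. chi (\<Gamma> (a \<union> B))) / 2 ^ card R1"
    by blast
  have "chi (\<Gamma> {r \<in> R0 \<union> R1. r N x}) = (\<Sum>C\<in>Pow R1. c {r \<in> R0. r N x} C * chi (comb C N x))" for N x
  proof -
    have "{r \<in> R0 \<union> R1. r N x} = {r \<in> R0. r N x} \<union> {r \<in> R1. r N x}" by auto
    then show ?thesis
      using c(1)[of "{r \<in> R1. r N x}" "{r \<in> R0. r N x}"]
      by (auto simp: comb_profile intro!: sum.cong)
  qed
  with c(2) that show thesis by blast
qed

context ultra begin

lemma biasedI: "0 < \<kappa> \<Longrightarrow> \<forall>\<^sub>F N in U. \<kappa> \<le> \<bar>ex (M N) (\<lambda>x. chi (f N x))\<bar> \<Longrightarrow> biased M f"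
  unfolding biased_def
proof
  assume *: "0 < \<kappa>" "\<forall>\<^sub>F N in U. \<kappa> \<le> \<bar>ex (M N) (\<lambda>x. chi (f N x))\<bar>"
    and "((\<lambda>N. ex (M N) (\<lambda>x. chi (f N x))) \<longlongrightarrow> 0) U"
  then have "\<forall>\<^sub>F N in U. \<bar>ex (M N) (\<lambda>x. chi (f N x))\<bar> < \<kappa>"
    by (auto simp: tendsto_iff)
  with *(2) have "\<forall>\<^sub>F N in U. False" by eventually_elim simp
  then show False using nontriv by (simp add: eventually_False)
qed

text \<open>Base point and directions are additive functions of \<open>y\<close>, hence so is every
  vertex. Substituting the vertices into \<open>T\<close> keeps the degree, and finitely many
  vertices need finitely many polynomials.\<close>

lemma alg_cub:
  assumes T: "finite T" "T \<subseteq> Pol M k"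
    and F: "\<And>N x. x \<in> cube (M N) \<Longrightarrow> F N x = \<Gamma> {r \<in> T. r N x}"
    and \<phi>: "\<And>N y. y \<in> cube (M' N) \<Longrightarrow> \<phi> N y \<in> cube (M N)"
      "\<And>N y h. y \<in> cube (M' N) \<Longrightarrow> h \<in> cube (M' N) \<Longrightarrow> \<phi> N (y \<oplus> h) = \<phi> N y \<oplus> \<phi> N h"
    and \<psi>: "\<And>N y. y \<in> cube (M' N) \<Longrightarrow> \<psi> N y \<in> cube (M N * j)"
      "\<And>N y h. y \<in> cube (M' N) \<Longrightarrow> h \<in> cube (M' N) \<Longrightarrow> \<psi> N (y \<oplus> h) = \<psi> N y \<oplus> \<psi> N h"
  shows "\<exists>T'. finite T' \<and> T' \<subseteq> Pol M' k \<and> alg M' T' (\<lambda>N y. cub (M N) j (F N) (\<phi> N y) (\<psi> N y))"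
  using \<phi> \<psi>
proof (induction j arbitrary: \<phi> \<psi>)
  case 0
  define p where "p r = (\<lambda>N y. r N (\<phi> N y))" for r :: fseq
  have "p r \<in> Pol M' k" if "r \<in> T" for r
  proof -
    have "deglt (M N) k (r N)" for N using T that by (auto simp: Pol_def)
    then have "deglt (M' N) k (\<lambda>y. r N (\<phi> N y))" for N
      by (rule deglt_pullback[where l = "\<phi> N"]) (use "0.prems" in auto)
    then show ?thesis by (simp add: Pol_def p_def)
  qed
  moreover have "alg M' (p ` T) (\<lambda>N y. cub (M N) 0 (F N) (\<phi> N y) (\<psi> N y))"
  proof (rule alg_exact[where \<Gamma> = "\<lambda>S. \<Gamma> {r \<in> T. p r \<in> S}"])
    fix N x assume "x \<in> cube (M' N)"
    then have "F N (\<phi> N x) = \<Gamma> {r \<in> T. r N (\<phi> N x)}" using "0.prems" by (intro F)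
    moreover have "{r \<in> T. p r \<in> {s \<in> p ` T. s N x}} = {r \<in> T. r N (\<phi> N x)}"
      by (auto simp: p_def)
    ultimately show "cub (M N) 0 (F N) (\<phi> N x) (\<psi> N x) = \<Gamma> {r \<in> T. p r \<in> {s \<in> p ` T. s N x}}"
      by simp
  qed
  ultimately show ?case
    using T by (intro exI[of _ "p ` T"]) auto
next
  case (Suc j)
  let ?h = "\<lambda>N y. take (M N) (\<psi> N y)" and ?\<psi> = "\<lambda>N y. drop (M N) (\<psi> N y)"
  let ?\<phi> = "\<lambda>N y. \<phi> N y \<oplus> ?h N y"
  have h: "?h N y \<in> cube (M N)" "?\<psi> N y \<in> cube (M N * j)" if "y \<in> cube (M' N)" for N y
    using Suc.prems(3)[OF that] by (auto simp: in_cube)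
  have \<psi>: "?\<psi> N (y \<oplus> h) = ?\<psi> N y \<oplus> ?\<psi> N h" if "y \<in> cube (M' N)" "h \<in> cube (M' N)" for N y h
    using Suc.prems(4)[OF that] by (simp add: drop_vadd)
  have \<phi>: "?\<phi> N (y \<oplus> h) = ?\<phi> N y \<oplus> ?\<phi> N h" if "y \<in> cube (M' N)" "h \<in> cube (M' N)" for N y h
    unfolding Suc.prems(2)[OF that] Suc.prems(4)[OF that] take_vadd
    by (metis vadd_assoc vadd_commute)
  have "\<exists>T'. finite T' \<and> T' \<subseteq> Pol M' k \<and> alg M' T' (\<lambda>N y. cub (M N) j (F N) (\<phi> N y) (?\<psi> N y))"
    using Suc.prems(1,2) h(2) \<psi> by (rule Suc.IH)
  then obtain T1 where T1: "finite T1" "T1 \<subseteq> Pol M' k"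
    "alg M' T1 (\<lambda>N y. cub (M N) j (F N) (\<phi> N y) (?\<psi> N y))"
    by (elim exE conjE)
  have "\<exists>T'. finite T' \<and> T' \<subseteq> Pol M' k \<and> alg M' T' (\<lambda>N y. cub (M N) j (F N) (?\<phi> N y) (?\<psi> N y))"
    using vadd_in_cube[OF Suc.prems(1) h(1)] \<phi> h(2) \<psi> by (rule Suc.IH)
  then obtain T2 where T2: "finite T2" "T2 \<subseteq> Pol M' k"
    "alg M' T2 (\<lambda>N y. cub (M N) j (F N) (?\<phi> N y) (?\<psi> N y))"
    by (elim exE conjE)
  have "alg M' (T1 \<union> T2) (\<lambda>N y. cub (M N) (Suc j) (F N) (\<phi> N y) (\<psi> N y))"
    unfolding cub.simps using T1(3) T2(3) by (intro alg_xor) (auto intro: alg_mono)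
  with T1 T2 show ?case
    by (intro exI[of _ "T1 \<union> T2"]) auto
qed

end

section \<open>Biased polynomials\<close>

lemma ex_power2: "(ex m g)\<^sup>2 = ex m (\<lambda>z'. ex m (\<lambda>z. g z * g z'))"
proof -
  have "ex m (\<lambda>z'. ex m (\<lambda>z. g z * g z')) = ex m (\<lambda>z'. ex m g * g z')"
    by (rule ex_cong) (rule ex_multc)
  then show ?thesis by (simp add: ex_cmult power2_eq_square)
qed

context ultra begin

lemma tendsto_0_mono:
  fixes f g :: "nat \<Rightarrow> real"
  assumes "(g \<longlongrightarrow> 0) U" "\<And>N. 0 \<le> f N" "\<And>N. f N \<le> g N"
  shows "(f \<longlongrightarrow> 0) U"
  by (rule tendsto_sandwich[OF _ _ tendsto_const assms(1)]) (use assms in auto)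

text \<open>If \<open>G(x, z)\<close> votes for \<open>P x\<close> with a clear majority over \<open>z\<close>, and \<open>G\<close> is a function of \<open>R0(x)\<close>
  and of \<open>R1(x, z)\<close>, which is nearly uniform for most \<open>x\<close>, then \<open>R0(x)\<close> determines the outcome.\<close>

lemma alg_of_vote:
  fixes M H :: "nat \<Rightarrow> nat"
  defines "M' \<equiv> \<lambda>N. M N + H N"
  assumes alg: "alg M' (R0 \<union> R1) G"
    and fin: "finite R0" "finite R1"
    and R0: "\<And>r N x z. r \<in> R0 \<Longrightarrow> x \<in> cube (M N) \<Longrightarrow> z \<in> cube (H N) \<Longrightarrow> r N (x @ z) = res r N x"
    and neut: "\<And>C. C \<subseteq> R1 \<Longrightarrow> C \<noteq> {} \<Longrightarrow>
      ((\<lambda>N. ex (M N) (\<lambda>x. (ex (H N) (\<lambda>z. chi (comb C N (x @ z))))\<^sup>2)) \<longlongrightarrow> 0) U"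
    and vote: "\<forall>\<^sub>F N in U. \<forall>x\<in>cube (M N). chi (P N x) * ex (H N) (\<lambda>z. chi (G N (x @ z))) \<ge> 1 / 2"
  shows "alg M (res ` R0) P"
proof -
  obtain \<Gamma> where \<Gamma>: "null M' (\<lambda>N y. G N y \<noteq> \<Gamma> {r \<in> R0 \<union> R1. r N y})"
    using alg unfolding alg_def by (elim exE)
  obtain c where c: "\<And>N y. chi (\<Gamma> {r \<in> R0 \<union> R1. r N y}) =
      (\<Sum>C\<in>Pow R1. c {r \<in> R0. r N y} C * chi (comb C N y))"
    using walsh_profile[OF fin(2), of \<Gamma> R0 thesis] by (rule meta_mp) (rule that)
  define K where "K = (\<Sum>a\<in>Pow R0. \<Sum>C\<in>Pow R1. \<bar>c a C\<bar>)"
  have K: "\<bar>c a C\<bar> \<le> K" if "a \<subseteq> R0" "C \<subseteq> R1" for a C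
  proof -
    have "\<bar>c a C\<bar> \<le> (\<Sum>C\<in>Pow R1. \<bar>c a C\<bar>)"
      using that fin by (intro member_le_sum) auto
    also have "\<dots> \<le> K"
      unfolding K_def using that fin by (intro member_le_sum) (auto intro: sum_nonneg)
    finally show ?thesis .
  qed
  define V where "V N C x = ex (H N) (\<lambda>z. chi (comb C N (x @ z)))" for N C x
  define a where "a N x = {r \<in> R0. res r N x}" for N x
  define W where "W N x = ex (H N) (\<lambda>z. of_bool (G N (x @ z) \<noteq> \<Gamma> {r \<in> R0 \<union> R1. r N (x @ z)}))"
    for N x
  \<comment> \<open>Two errors at \<open>x\<close>: the share of \<open>z\<close> where the
    representation by \<Gamma> fails, and the nonconstant characters averaged over the fibre, with
    \<open>K\<close> bounding all coefficients.\<close>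
  define e where "e N x = 2 * W N x + (\<Sum>C\<in>Pow R1 - {{}}. K * \<bar>V N C x\<bar>)" for N x
  have close: "\<bar>ex (H N) (\<lambda>z. chi (G N (x @ z))) - c (a N x) {}\<bar> \<le> e N x"
    if x: "x \<in> cube (M N)" for N x
  proof -
    have prof: "{r \<in> R0. r N (x @ z)} = a N x" if "z \<in> cube (H N)" for z
      using R0 x that by (auto simp: a_def)
    have "ex (H N) (\<lambda>z. chi (\<Gamma> {r \<in> R0 \<union> R1. r N (x @ z)}))
        = ex (H N) (\<lambda>z. \<Sum>C\<in>Pow R1. c (a N x) C * chi (comb C N (x @ z)))"
      unfolding c by (intro ex_cong) (simp add: prof)
    also have "\<dots> = (\<Sum>C\<in>Pow R1. c (a N x) C * V N C x)"
      unfolding ex_sum ex_cmult V_def ..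
    also have "\<dots> = c (a N x) {} * V N {} x + (\<Sum>C\<in>Pow R1 - {{}}. c (a N x) C * V N C x)"
      using fin by (intro sum.remove) auto
    also have "V N {} x = 1" by (simp add: V_def comb_def)
    finally have 1: "ex (H N) (\<lambda>z. chi (\<Gamma> {r \<in> R0 \<union> R1. r N (x @ z)})) - c (a N x) {}
        = (\<Sum>C\<in>Pow R1 - {{}}. c (a N x) C * V N C x)" by simp
    have "\<bar>\<Sum>C\<in>Pow R1 - {{}}. c (a N x) C * V N C x\<bar> \<le> (\<Sum>C\<in>Pow R1 - {{}}. \<bar>c (a N x) C * V N C x\<bar>)"
      by (rule sum_abs)
    also have "\<dots> \<le> (\<Sum>C\<in>Pow R1 - {{}}. K * \<bar>V N C x\<bar>)"
      unfolding abs_mult by (intro sum_mono mult_right_mono K) (auto simp: a_def)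
    finally have 2: "\<bar>ex (H N) (\<lambda>z. chi (\<Gamma> {r \<in> R0 \<union> R1. r N (x @ z)})) - c (a N x) {}\<bar>
        \<le> (\<Sum>C\<in>Pow R1 - {{}}. K * \<bar>V N C x\<bar>)" unfolding 1 .
    have "\<bar>ex (H N) (\<lambda>z. chi (G N (x @ z))) - ex (H N) (\<lambda>z. chi (\<Gamma> {r \<in> R0 \<union> R1. r N (x @ z)}))\<bar>
        \<le> ex (H N) (\<lambda>z. \<bar>chi (G N (x @ z)) - chi (\<Gamma> {r \<in> R0 \<union> R1. r N (x @ z)})\<bar>)"
      unfolding ex_diff[symmetric] by (rule ex_abs)
    also have "\<dots> = ex (H N) (\<lambda>z. 2 * of_bool (G N (x @ z) \<noteq> \<Gamma> {r \<in> R0 \<union> R1. r N (x @ z)}))"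
      by (intro ex_cong) (auto simp: chi_def)
    also have "\<dots> = 2 * W N x"
      unfolding W_def by (rule ex_cmult)
    finally show ?thesis using 2 by (simp add: e_def)
  qed
  have W: "((\<lambda>N. ex (M N) (W N)) \<longlongrightarrow> 0) U"
    using \<Gamma> unfolding null_def M'_def ex_append W_def .
  \<comment> \<open>Neutrality is a mean-square statement; by Cauchy-Schwarz it gives smallness in
    mean.\<close>
  have "((\<lambda>N. ex (M N) (\<lambda>x. \<bar>V N C x\<bar>)) \<longlongrightarrow> 0) U" if "C \<subseteq> R1" "C \<noteq> {}" for C
  proof (rule tendsto_0_mono)
    show "((\<lambda>N. sqrt (ex (M N) (\<lambda>x. (V N C x)\<^sup>2))) \<longlongrightarrow> 0) U"
      using tendsto_real_sqrt[OF neut[OF that]] by (simp add: V_def)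
    show "0 \<le> ex (M N) (\<lambda>x. \<bar>V N C x\<bar>)" for N by (intro ex_nonneg) simp
    show "ex (M N) (\<lambda>x. \<bar>V N C x\<bar>) \<le> sqrt (ex (M N) (\<lambda>x. (V N C x)\<^sup>2))" for N
      using ex_square_le[of "M N" "\<lambda>x. \<bar>V N C x\<bar>"] by (intro real_le_rsqrt) simp
  qed
  then have "((\<lambda>N. 2 * (2 * ex (M N) (W N) + (\<Sum>C\<in>Pow R1 - {{}}. K * ex (M N) (\<lambda>x. \<bar>V N C x\<bar>)))) \<longlongrightarrow>
      2 * (2 * 0 + (\<Sum>C\<in>Pow R1 - {{}}. K * 0))) U"
    by (intro tendsto_intros W) auto
  moreover have "ex (M N) (\<lambda>x. 2 * e N x) =
      2 * (2 * ex (M N) (W N) + (\<Sum>C\<in>Pow R1 - {{}}. K * ex (M N) (\<lambda>x. \<bar>V N C x\<bar>)))" for N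
    unfolding e_def ex_cmult ex_add ex_sum ..
  ultimately have e0: "((\<lambda>N. ex (M N) (\<lambda>x. 2 * e N x)) \<longlongrightarrow> 0) U" by simp
  \<comment> \<open>Where the sign of \<open>c (a N x) {}\<close> disagrees with \<open>P\<close>,
    the majority of at least 1/2 forces \<open>e N x\<close> to be at least 1/2; Markov's inequality
    explains the factor 2.\<close>
  have "null M (\<lambda>N x. P N x \<noteq> (c (a N x) {} < 0))"
    using e0
  proof (rule null_bound)
    show "\<forall>\<^sub>F N in U. ex (M N) (\<lambda>x. of_bool (P N x \<noteq> (c (a N x) {} < 0))) \<le> ex (M N) (\<lambda>x. 2 * e N x)"
      using vote
    proof eventually_elim
      case (elim N)
      show ?case
      proof (rule ex_mono)
        fix x assume x: "x \<in> cube (M N)"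
        have "0 \<le> e N x" using close[OF x] by linarith
        moreover have "1 / 2 \<le> e N x" if "P N x \<noteq> (c (a N x) {} < 0)"
          using close[OF x] elim x that by (cases "P N x") force+
        ultimately show "of_bool (P N x \<noteq> (c (a N x) {} < 0)) \<le> 2 * e N x" by auto
      qed
    qed
  qed
  \<comment> \<open>\<open>res\<close> may identify members of \<open>R0\<close>, so the profile is
    pulled back along it.\<close>
  moreover have "a N x = {r \<in> R0. res r \<in> {s \<in> res ` R0. s N x}}" for N x
    by (auto simp: a_def)
  ultimately show ?thesis
    unfolding alg_def by (intro exI[of _ "\<lambda>S. c {r \<in> R0. res r \<in> S} {} < 0"]) simp
qed

text \<open>The induction on the degree runs over all dimensions at once: regularization takes place
  on the larger cube of base points and directions, and there it needs this structure theorem for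
  smaller degree bounds.\<close>

lemma biased_struct:
  assumes "P \<in> Pol M k" "biased M P"
  shows "\<exists>T. finite T \<and> T \<subseteq> (\<Union>j<k. Pol M j) \<and> alg M T P"
  using assms
proof (induction k arbitrary: M P rule: less_induct)
  case (less k')
  show ?case
  proof (cases k')
    case 0
    have "alg M {} P"
      by (rule alg_exact[where \<Gamma> = "\<lambda>_. False"]) (use less.prems 0 in \<open>auto simp: Pol_def\<close>)
    then show ?thesis by (intro exI[of _ "{}"]) auto
  next
    case (Suc k)
    define b where "b = (\<lambda>N. ex (M N) (\<lambda>x. chi (P N x)))"
    obtain \<kappa> where \<kappa>: "0 < \<kappa>" "\<forall>\<^sub>F N in U. \<kappa> \<le> \<bar>b N\<bar>"
      using not_tendsto_0D[of b] less.prems(2) by (auto simp: biased_def b_def)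
    \<comment> \<open>\<open>U\<close> decides the sign of the bias, so one orientation of the vote
      serves \<open>U\<close>-most \<open>N\<close>.\<close>
    obtain sg :: real where sg: "\<bar>sg\<bar> = 1" "\<forall>\<^sub>F N in U. \<kappa> \<le> sg * b N"
    proof -
      consider "\<forall>\<^sub>F N in U. 0 \<le> b N" | "\<forall>\<^sub>F N in U. \<not> 0 \<le> b N" using ultra by blast
      then show thesis
      proof cases
        case 1
        then have "\<forall>\<^sub>F N in U. \<kappa> \<le> 1 * b N" using \<kappa>(2) by eventually_elim simp
        then show thesis by (intro that[of 1]) auto
      next
        case 2
        then have "\<forall>\<^sub>F N in U. \<kappa> \<le> -1 * b N" using \<kappa>(2) by eventually_elim simp
        then show thesis by (intro that[of "-1"]) auto
      qed
    qed
    \<comment> \<open>\<open>Suc k\<close> directions make the parallelepiped sum of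
      \<open>P\<close> vanish. The sample size \<open>s\<close> brings the error of the vote down to
      1 / (4 * 2^n), small enough for a union bound over 2^n vertices.\<close>
    define n where "n = Suc k"
    obtain s :: nat where s: "4 * 2 ^ n / \<kappa>\<^sup>2 < real s" using reals_Archimedean2 by blast
    have "0 < 4 * 2 ^ n / \<kappa>\<^sup>2" using \<kappa> by simp
    then have s0: "0 < s" using s by (metis of_nat_0_less_iff order_less_trans)
    have "\<exists>hs. \<forall>N. (\<forall>j. hs N j \<in> cube (M N)) \<and>
        ex (M N) (\<lambda>x. (\<Sum>j<s. chi (P N (x \<oplus> hs N j)) - b N)\<^sup>2) \<le> real s"
      unfolding b_def by (intro choice allI sampled_translates)
    then obtain hs where hs: "\<And>N j. hs N j \<in> cube (M N)"
      "\<And>N. ex (M N) (\<lambda>x. (\<Sum>j<s. chi (P N (x \<oplus> hs N j)) - b N)\<^sup>2) \<le> real s" by blast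
    define D where "D j = (\<lambda>N x. P N x \<noteq> P N (x \<oplus> hs N j))" for j
    define A where "A = (\<lambda>N x. sg * (\<Sum>j<s. chi (D j N x)) < 0)"
    have D_Pol: "D j \<in> Pol M k" for j
      using less.prems(1) hs(1) unfolding Suc Pol_def D_def by auto
    have A_exact: "A N x = (sg * (\<Sum>j<s. chi (D j \<in> {r \<in> D ` {..<s}. r N x})) < 0)" for N x
    proof -
      have "(\<Sum>j<s. chi (D j \<in> {r \<in> D ` {..<s}. r N x})) = (\<Sum>j<s. chi (D j N x))"
        by (intro sum.cong) auto
      then show ?thesis by (simp add: A_def)
    qed
    define \<beta> where "\<beta> N = ex (M N) (\<lambda>x. of_bool (A N x \<noteq> P N x))" for N
    have \<beta>: "\<forall>\<^sub>F N in U. 2 ^ n * \<beta> N \<le> 1 / 4"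
      using sg(2)
    proof eventually_elim
      case (elim N)
      have "\<beta> N \<le> 1 / (real s * \<kappa>\<^sup>2)"
        unfolding \<beta>_def A_def D_def
        using sg(1) elim \<kappa>(1) s0 hs(2)[of N] unfolding b_def by (rule derivative_vote)
      also have "\<dots> \<le> 1 / (4 * 2 ^ n)"
        using s s0 \<kappa> by (intro divide_left_mono) (auto simp: field_simps)
      finally show ?case by (simp add: field_simps)
    qed

    define H where "H N = M N * n" for N
    define M' where "M' N = M N + H N" for N
    \<comment> \<open>Adding \<open>A\<close> at the base point cancels that vertex, so
      \<open>G\<close> is the sum of \<open>A\<close> over all other vertices.\<close>
    define G where "G = (\<lambda>N y. cub (M N) n (A N) (take (M N) y) (drop (M N) y) \<noteq> A N (take (M N) y))"
    have take_M': "take (M N) y \<in> cube (M N)" "drop (M N) y \<in> cube (H N)" if "y \<in> cube (M' N)" for N y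
      using that by (auto simp: in_cube M'_def)
    obtain T where T: "finite T" "T \<subseteq> Pol M' k" "alg M' T G"
    proof -
      have D_fin: "finite (D ` {..<s})" "D ` {..<s} \<subseteq> Pol M k" using D_Pol by auto
      have "\<exists>T'. finite T' \<and> T' \<subseteq> Pol M' k \<and>
          alg M' T' (\<lambda>N y. cub (M N) n (A N) (take (M N) y) (drop (M N) y))"
        by (rule alg_cub[OF D_fin, where \<Gamma> = "\<lambda>S. sg * (\<Sum>j<s. chi (D j \<in> S)) < 0"])
           (use A_exact take_M' in \<open>auto simp: take_vadd drop_vadd H_def\<close>)
      then obtain T1 where T1: "finite T1" "T1 \<subseteq> Pol M' k"
        "alg M' T1 (\<lambda>N y. cub (M N) n (A N) (take (M N) y) (drop (M N) y))" by (elim exE conjE)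
      have "\<exists>T'. finite T' \<and> T' \<subseteq> Pol M' k \<and> alg M' T' (\<lambda>N y. cub (M N) 0 (A N) (take (M N) y) [])"
        by (rule alg_cub[OF D_fin, where \<Gamma> = "\<lambda>S. sg * (\<Sum>j<s. chi (D j \<in> S)) < 0"])
           (use A_exact take_M'(1) in \<open>auto simp: take_vadd vadd_def[of "[]"] in_cube[of "[]"]\<close>)
      then obtain T2 where T2: "finite T2" "T2 \<subseteq> Pol M' k"
        "alg M' T2 (\<lambda>N y. cub (M N) 0 (A N) (take (M N) y) [])" by (elim exE conjE)
      have "alg M' (T1 \<union> T2) G"
        unfolding G_def using T1(3) T2(3) by (intro alg_xor) (auto intro: alg_mono)
      with T1 T2 show thesis by (intro that[of "T1 \<union> T2"]) auto
    qed
    have vote: "\<forall>\<^sub>F N in U. \<forall>x\<in>cube (M N). chi (P N x) * ex (H N) (\<lambda>z. chi (G N (x @ z))) \<ge> 1 / 2"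
      using \<beta>
    proof eventually_elim
      case (elim N)
      show ?case
      proof
        fix x assume x: "x \<in> cube (M N)"
        define B where "B = (\<lambda>x. A N x \<noteq> P N x)"
        \<comment> \<open>As the parallelepiped sum of \<open>P\<close> vanishes, \<open>G\<close>
          misses \<open>P\<close> at \<open>x\<close> exactly when the errors \<open>B\<close> at
          the other vertices have odd sum.\<close>
        have G_eq: "(G N (x @ z) \<noteq> P N x) = (cub (M N) n B x z \<noteq> B x)" if z: "z \<in> cube (H N)" for z
        proof -
          have "\<not> cub (M N) n (P N) x z"
            using less.prems(1) x z by (intro cub_deglt) (auto simp: Suc n_def Pol_def H_def)
          moreover have "take (M N) (x @ z) = x" "drop (M N) (x @ z) = z"
            using x by (auto simp: in_cube)
          ultimately show ?thesis
            unfolding B_def cub_xor G_def by auto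
        qed
        \<comment> \<open>An error probability of at most 1/4 over the directions leaves a
          correlation of at least 1 - 2/4.\<close>
        have "1 - chi (P N x) * ex (H N) (\<lambda>z. chi (G N (x @ z)))
            = ex (H N) (\<lambda>z. 1 - chi (P N x) * chi (G N (x @ z)))"
          unfolding ex_diff ex_cmult by simp
        also have "\<dots> = ex (H N) (\<lambda>z. 2 * of_bool (G N (x @ z) \<noteq> P N x))"
          by (intro ex_cong) (auto simp: chi_def)
        also have "\<dots> = 2 * ex (H N) (\<lambda>z. of_bool (cub (M N) n B x z \<noteq> B x))"
          unfolding ex_cmult by (intro arg_cong[where f = "\<lambda>t. 2 * t"] ex_cong) (simp only: G_eq)
        also have "\<dots> \<le> 2 * ((2 ^ n - 1) * \<beta> N)"
          using ex_cub_le[OF x, of n B] by (simp add: H_def \<beta>_def B_def)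
        also have "\<dots> \<le> 2 * (2 ^ n * \<beta> N)"
          by (intro mult_left_mono mult_right_mono) (auto simp: \<beta>_def intro: ex_nonneg)
        finally show "1 / 2 \<le> chi (P N x) * ex (H N) (\<lambda>z. chi (G N (x @ z)))"
          using elim by simp
      qed
    qed

    define res where "res r = (\<lambda>N x. r N (x @ replicate (H N) False))" for r :: fseq
    define Q0 where "Q0 = {r \<in> Pol M' k. \<forall>N. \<forall>x\<in>cube (M N). \<forall>z\<in>cube (H N). r N (x @ z) = res r N x}"
    \<comment> \<open>Members of \<open>Q0\<close> are constant on the fibres over \<open>x\<close>,
      so averages over whole fibres already respect the atoms of \<open>R0\<close>.\<close>
    define neut where "neut = (\<lambda>(R0 :: fseq set) q.
      ((\<lambda>N. ex (M N) (\<lambda>x. (ex (H N) (\<lambda>z. chi (q N (x @ z))))\<^sup>2)) \<longlongrightarrow> 0) U)"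
    have step: "\<exists>q0\<in>Q0 \<inter> Pol M' j. biased M' (\<lambda>N x. q N x \<noteq> q0 N x)"
      if j: "j \<le> k" "q \<in> Pol M' j" and nn: "\<not> neut R0 q" for j q R0
    proof -
      define v where "v = (\<lambda>N. ex (M N) (\<lambda>x. (ex (H N) (\<lambda>z. chi (q N (x @ z))))\<^sup>2))"
      obtain \<epsilon> where \<epsilon>: "0 < \<epsilon>" "\<forall>\<^sub>F N in U. \<epsilon> \<le> \<bar>v N\<bar>"
        using not_tendsto_0D[of v] nn by (auto simp: neut_def v_def)
      have "\<exists>z'\<in>cube (H N). v N \<le> ex (M' N) (\<lambda>y. chi (q N y) * chi (q N (take (M N) y @ z')))" for N
      proof -
        \<comment> \<open>The squared fibre average correlates \<open>q\<close> at two independent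
          choices \<open>z\<close> and \<open>z'\<close> of directions; some fixed \<open>z'\<close>
          does at least as well as the average. Freezing it gives \<open>q0\<close>, a polynomial in
          \<open>x\<close> alone.\<close>
        have "v N = ex (M N) (\<lambda>x. ex (H N) (\<lambda>z'. ex (H N) (\<lambda>z. chi (q N (x @ z)) * chi (q N (x @ z')))))"
          unfolding v_def ex_power2 ..
        also have "\<dots> = ex (H N) (\<lambda>z'. ex (M N) (\<lambda>x. ex (H N) (\<lambda>z. chi (q N (x @ z)) * chi (q N (x @ z')))))"
          by (rule ex_swap)
        also have "\<dots> = ex (H N) (\<lambda>z'. ex (M' N) (\<lambda>y. chi (q N y) * chi (q N (take (M N) y @ z'))))"
          unfolding M'_def ex_append by (intro ex_cong) (simp add: in_cube)
        finally show ?thesis using ex_le_attained by simp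
      qed
      then obtain z' where z': "\<And>N. z' N \<in> cube (H N)"
        "\<And>N. v N \<le> ex (M' N) (\<lambda>y. chi (q N y) * chi (q N (take (M N) y @ z' N)))" by metis
      define q0 where "q0 = (\<lambda>N y. q N (take (M N) y @ z' N))"
      have "deglt (M' N) j (q0 N)" for N
        unfolding q0_def
      proof (rule deglt_pullback)
        show "deglt (M' N) j (q N)" using j(2) by (simp add: Pol_def)
        show "take (M N) x @ z' N \<in> cube (M' N)" "take (M N) x @ replicate (H N) False \<in> cube (M' N)"
          if "x \<in> cube (M' N)" for x
          using that z'(1)[of N] by (auto simp: in_cube M'_def)
        show "take (M N) (x \<oplus> h) @ z' N = (take (M N) x @ z' N) \<oplus> (take (M N) h @ replicate (H N) False)"
          if "x \<in> cube (M' N)" "h \<in> cube (M' N)" for x h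
          using that z'(1)[of N] by (simp add: in_cube take_vadd vadd_append vadd_replicate_False)
      qed
      then have "q0 \<in> Pol M' j" by (simp add: Pol_def)
      moreover have "q0 \<in> Q0"
        using Pol_mono[OF \<open>q0 \<in> Pol M' j\<close> j(1)]
        by (auto simp: Q0_def q0_def res_def in_cube)
      moreover have "\<forall>\<^sub>F N in U. \<epsilon> \<le> \<bar>ex (M' N) (\<lambda>y. chi (q N y \<noteq> q0 N y))\<bar>"
        using \<epsilon>(2)
      proof eventually_elim
        case (elim N)
        moreover have "0 \<le> v N" unfolding v_def by (intro ex_nonneg) simp
        ultimately show ?case
          using z'(2)[of N] unfolding chi_neq q0_def by linarith
      qed
      ultimately show ?thesis by (intro bexI[of _ q0] biasedI[OF \<epsilon>(1)]) auto
    qed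
    \<comment> \<open>A single family is regularized here, so the index type is \<open>unit\<close>
      and large means nonempty.\<close>
    have "\<exists>\<Sigma>'\<subseteq>{()}. \<Sigma>' \<noteq> {} \<and> (\<exists>R0' R1'. finite R0' \<and> {} \<subseteq> R0' \<and> R0' \<subseteq> Q0 \<and>
      (\<forall>\<sigma>\<in>\<Sigma>'. finite (R1' \<sigma>) \<and> (\<forall>r\<in>T. alg M' (R0' \<union> R1' \<sigma>) r) \<and>
        (\<forall>C\<subseteq>R1' \<sigma>. C \<noteq> {} \<longrightarrow> neut R0' (comb C))))"
    proof (rule regularization[where K = k and D = "image_mset (sdeg M') (mset_set T)"])
      show "\<exists>T. finite T \<and> T \<subseteq> (\<Union>i<j. Pol M' i) \<and> alg M' T f"
        if "j \<le> k" "f \<in> Pol M' j" "biased M' f" for j f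
        using that Suc by (intro less.IH) auto
      show "\<exists>\<Sigma>'\<subseteq>\<Sigma>. \<Sigma>' \<noteq> {} \<and> (\<exists>q0\<in>Q0 \<inter> Pol M' j. \<forall>\<sigma>\<in>\<Sigma>'. biased M' (\<lambda>N x. q \<sigma> N x \<noteq> q0 N x))"
        if ne: "\<Sigma> \<noteq> {}" and j: "j \<le> k" and q: "\<And>\<sigma>. \<sigma> \<in> \<Sigma> \<Longrightarrow> q \<sigma> \<in> Pol M' j \<and> \<not> neut R0 (q \<sigma>)"
        for \<Sigma> :: "unit set" and j R0 q
      proof -
        have \<Sigma>: "() \<in> \<Sigma>" using ne by auto
        then obtain q0 where "q0 \<in> Q0 \<inter> Pol M' j" "biased M' (\<lambda>N x. q () N x \<noteq> q0 N x)"
          using step[OF j, of "q ()" R0] q[OF \<Sigma>] by blast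
        with \<Sigma> show ?thesis by (intro exI[of _ \<Sigma>]) auto
      qed
    qed (use T in auto)
    then obtain R0 R1 where R: "finite R0" "R0 \<subseteq> Q0" "finite R1"
      "\<And>r. r \<in> T \<Longrightarrow> alg M' (R0 \<union> R1) r" "\<And>C. C \<subseteq> R1 \<Longrightarrow> C \<noteq> {} \<Longrightarrow> neut R0 (comb C)"
      by (metis (no_types, lifting) subset_singletonD singletonI)
    have "alg M' (R0 \<union> R1) G" using T(3,1) R(4) by (rule alg_trans)
    then have "alg M (res ` R0) P"
      using vote R unfolding neut_def M'_def
      by (intro alg_of_vote[where H = H and ?R1.0 = R1]) (auto simp: Q0_def)
    moreover have "res r \<in> Pol M k" if "r \<in> R0" for r
    proof -
      have "deglt (M N) k (res r N)" for N
        unfolding res_def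
      proof (rule deglt_pullback)
        show "deglt (M' N) k (r N)" using that R(2) by (auto simp: Q0_def Pol_def)
        show "x @ replicate (H N) False \<in> cube (M' N)" "x @ replicate (H N) False \<in> cube (M' N)"
          if "x \<in> cube (M N)" for x
          using that by (auto simp: in_cube M'_def)
        show "(x \<oplus> h) @ replicate (H N) False = (x @ replicate (H N) False) \<oplus> (h @ replicate (H N) False)"
          if "x \<in> cube (M N)" "h \<in> cube (M N)" for x h
          using that by (simp add: in_cube vadd_append vadd_replicate_False)
      qed
      then show ?thesis by (simp add: Pol_def)
    qed
    ultimately show ?thesis
      using R(1) Suc by (intro exI[of _ "res ` R0"]) auto
  qed
qed

end

section \<open>Comparison with independent bits\<close>

lemma sum_cube_Suc: "(\<Sum>y\<in>cube (Suc n). g y) = (\<Sum>y\<in>cube n. g (True # y) + g (False # y :: bool list) :: real)"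
proof -
  have "(\<Sum>y\<in>cube (Suc n). g y) = (\<Sum>(b, y)\<in>UNIV \<times> cube n. g (b # y))"
    by (rule sum.reindex_bij_witness[of _ "\<lambda>(b, y). b # y" "\<lambda>y. (hd y, tl y)"])
       (auto simp: in_cube length_Suc_conv)
  also have "\<dots> = (\<Sum>b\<in>UNIV. \<Sum>y\<in>cube n. g (b # y))"
    by (simp add: sum.cartesian_product)
  finally show ?thesis by (simp add: UNIV_bool sum.distrib add.commute)
qed

lemma ber13_Cons: "ber13 (Suc n) (b # y) = (if b then 1/3 else 2/3) * ber13 n y"
  by (simp add: ber13_def)

lemma ber13_nonneg: "0 \<le> ber13 n y"
  by (simp add: ber13_def)

lemma sum_ber13: "(\<Sum>y\<in>cube n. ber13 n y) = 1"
proof (induction n)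
  case 0
  have "cube 0 = {[]}" by (auto simp: in_cube)
  then show ?case by (simp add: ber13_def)
next
  case (Suc n)
  then show ?case
    by (simp add: sum_cube_Suc ber13_Cons flip: sum_distrib_left distrib_right)
qed

text \<open>A sign under Ber(1/3) has mean 2/3 - 1/3 = 1/3 and variance 1 - 1/9 = 8/9. When the
  first bit is split off, the cross term vanishes because its centred sign has mean 0.\<close>

lemma ber13_moments:
  fixes c :: "nat \<Rightarrow> real"
  shows "(\<Sum>y\<in>cube n. ber13 n y * (\<Sum>i<n. c i * (chi (y ! i) - 1/3))) = 0 \<and>
    (\<Sum>y\<in>cube n. ber13 n y * (\<Sum>i<n. c i * (chi (y ! i) - 1/3))\<^sup>2) = 8/9 * (\<Sum>i<n. (c i)\<^sup>2)"
proof (induction n arbitrary: c)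
  case (Suc n)
  define S where "S y = (\<Sum>i<n. c (Suc i) * (chi (y ! i) - 1/3))" for y
  have S: "(\<Sum>i<Suc n. c i * (chi ((b # y) ! i) - 1/3)) = c 0 * (chi b - 1/3) + S y" for b y
    unfolding sum.lessThan_Suc_shift by (simp add: S_def)
  note IH = Suc[of "\<lambda>i. c (Suc i)", folded S_def]
  have "(\<Sum>y\<in>cube (Suc n). ber13 (Suc n) y * (\<Sum>i<Suc n. c i * (chi (y ! i) - 1/3)))
      = (\<Sum>y\<in>cube n. ber13 n y * S y)"
    unfolding sum_cube_Suc S ber13_Cons by (intro sum.cong) (auto simp: field_simps)
  moreover have "(\<Sum>y\<in>cube (Suc n). ber13 (Suc n) y * (\<Sum>i<Suc n. c i * (chi (y ! i) - 1/3))\<^sup>2)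
      = (\<Sum>y\<in>cube n. 8/9 * (c 0)\<^sup>2 * ber13 n y + ber13 n y * (S y)\<^sup>2)"
    unfolding sum_cube_Suc S ber13_Cons
    by (intro sum.cong) (auto simp: field_simps power2_eq_square)
  moreover have "\<dots> = 8/9 * (c 0)\<^sup>2 + 8/9 * (\<Sum>i<n. (c (Suc i))\<^sup>2)"
    unfolding sum.distrib sum_distrib_left[symmetric] sum_ber13 using IH by simp
  ultimately show ?case
    using IH unfolding sum.lessThan_Suc_shift[of "\<lambda>i. (c i)\<^sup>2"] by (simp add: algebra_simps)
qed simp

lemma ex_pushforward:
  "ex m (\<lambda>x. h (map (\<lambda>i. Ps i x) [0..<n])) = (\<Sum>y\<in>cube n. poly_distr m n Ps y * h y)"
proof -
  let ?F = "\<lambda>x. map (\<lambda>i. Ps i x) [0..<n]"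
  have "(\<Sum>x\<in>cube m. h (?F x)) = (\<Sum>y\<in>cube n. \<Sum>x\<in>{x \<in> cube m. ?F x = y}. h (?F x))"
    by (rule sum.group[symmetric]) (auto simp: in_cube)
  also have "\<dots> = (\<Sum>y\<in>cube n. real (card {x \<in> cube m. ?F x = y}) * h y)"
    by (intro sum.cong) auto
  finally show ?thesis
    by (simp add: ex_def poly_distr_def sum_divide_distrib)
qed

text \<open>Mass that the output distribution shares with \<open>ber13\<close>, as a weight on the inputs.\<close>

lemma shared_weight:
  fixes m n :: nat and Ps :: "nat \<Rightarrow> bool list \<Rightarrow> bool"
  assumes tv: "tv_dist n (poly_distr m n Ps) (ber13 n) < 1 - \<epsilon>"
  obtains w :: "bool list \<Rightarrow> real" where "\<And>x. 0 \<le> w x" "\<And>x. w x \<le> 1" "\<epsilon> \<le> ex m w"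
    "\<And>c. ex m (\<lambda>x. w x * (\<Sum>i<n. c i * (chi (Ps i x) - 1/3))\<^sup>2) \<le> (\<Sum>i<n. (c i)\<^sup>2)"
proof
  let ?p = "poly_distr m n Ps" and ?q = "ber13 n"
  let ?F = "\<lambda>x. map (\<lambda>i. Ps i x) [0..<n]"
  \<comment> \<open>The fraction of the mass at \<open>y\<close> that is shared; where the output
    mass is 0, division by zero gives 0, consistently with the minimum.\<close>
  define u where "u y = min (?p y) (?q y) / ?p y" for y
  have p: "0 \<le> ?p y" for y by (simp add: poly_distr_def)
  have pu: "?p y * u y = min (?p y) (?q y)" for y
    using p[of y] ber13_nonneg[of n y] by (auto simp: u_def)
  show "0 \<le> u (?F x)" "u (?F x) \<le> 1" for x
    using p ber13_nonneg by (auto simp: u_def divide_le_eq_1 intro!: divide_nonneg_nonneg)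
       (metis order_le_less)
  have "(\<Sum>y\<in>cube n. ?p y) = 1"
    using ex_pushforward[of m "\<lambda>_. 1" Ps n] by simp
  moreover have "\<bar>?p y - ?q y\<bar> = ?p y + ?q y - 2 * min (?p y) (?q y)" for y
    by (simp add: min_def)
  ultimately have "tv_dist n ?p ?q = 1 - (\<Sum>y\<in>cube n. min (?p y) (?q y))"
    using sum_ber13[of n]
    by (simp add: tv_dist_def sum.distrib sum_subtractf flip: sum_distrib_left)
  moreover have "ex m (\<lambda>x. u (?F x)) = (\<Sum>y\<in>cube n. min (?p y) (?q y))"
    unfolding ex_pushforward pu ..
  ultimately show "\<epsilon> \<le> ex m (\<lambda>x. u (?F x))" using tv by simp
  fix c :: "nat \<Rightarrow> real"
  let ?h = "\<lambda>y. (\<Sum>i<n. c i * (chi (y ! i) - 1/3))\<^sup>2"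
  have "ex m (\<lambda>x. u (?F x) * (\<Sum>i<n. c i * (chi (Ps i x) - 1/3))\<^sup>2) = ex m (\<lambda>x. u (?F x) * ?h (?F x))"
    by (intro ex_cong) simp
  also have "\<dots> = (\<Sum>y\<in>cube n. ?p y * (u y * ?h y))"
    by (rule ex_pushforward)
  also have "\<dots> = (\<Sum>y\<in>cube n. min (?p y) (?q y) * ?h y)"
    by (simp add: pu flip: mult.assoc)
  also have "\<dots> \<le> (\<Sum>y\<in>cube n. ?q y * (\<Sum>i<n. c i * (chi (y ! i) - 1/3))\<^sup>2)"
    by (intro sum_mono mult_right_mono) auto
  also have "\<dots> \<le> (\<Sum>i<n. (c i)\<^sup>2)"
    using ber13_moments[THEN conjunct2, of n c] sum_nonneg[of "{..<n}" "\<lambda>i. (c i)\<^sup>2"] by simp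
  finally show "ex m (\<lambda>x. u (?F x) * (\<Sum>i<n. c i * (chi (Ps i x) - 1/3))\<^sup>2) \<le> (\<Sum>i<n. (c i)\<^sup>2)" .
qed

text \<open>The signs \<open>e\<close> make the correlations with \<open>g\<close> add up, and
  Cauchy-Schwarz bounds their sum by a second moment. For \<open>B\<close> of linear growth in
  \<open>card F\<close> this limits the size of \<open>F\<close>.\<close>

lemma bessel:
  fixes g :: "bool list \<Rightarrow> real" and v :: "'i \<Rightarrow> bool list \<Rightarrow> real"
  assumes "finite F" "0 \<le> \<kappa>" "\<And>\<sigma>. \<sigma> \<in> F \<Longrightarrow> \<kappa> \<le> \<bar>ex m (\<lambda>x. g x * v \<sigma> x)\<bar>"
    and B: "\<And>e :: 'i \<Rightarrow> real. (\<And>\<sigma>. \<bar>e \<sigma>\<bar> = 1) \<Longrightarrow>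
      ex m (\<lambda>x. (g x)\<^sup>2 * (\<Sum>\<sigma>\<in>F. e \<sigma> * v \<sigma> x)\<^sup>2) \<le> B"
  shows "(\<kappa> * card F)\<^sup>2 \<le> B"
proof -
  define e :: "'i \<Rightarrow> real" where "e \<sigma> = (if 0 \<le> ex m (\<lambda>x. g x * v \<sigma> x) then 1 else -1)" for \<sigma>
  have "\<kappa> * card F = (\<Sum>\<sigma>\<in>F. \<kappa>)" by simp
  also have "\<dots> \<le> (\<Sum>\<sigma>\<in>F. e \<sigma> * ex m (\<lambda>x. g x * v \<sigma> x))"
  proof (rule sum_mono)
    show "\<kappa> \<le> e \<sigma> * ex m (\<lambda>x. g x * v \<sigma> x)" if "\<sigma> \<in> F" for \<sigma>
      using assms(3)[OF that] by (simp add: e_def abs_if split: if_splits)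
  qed
  also have "\<dots> = ex m (\<lambda>x. \<Sum>\<sigma>\<in>F. e \<sigma> * (g x * v \<sigma> x))"
    unfolding ex_sum ex_cmult ..
  also have "\<dots> = ex m (\<lambda>x. g x * (\<Sum>\<sigma>\<in>F. e \<sigma> * v \<sigma> x))"
    by (simp add: sum_distrib_left mult_ac)
  finally have "(\<kappa> * card F)\<^sup>2 \<le> (ex m (\<lambda>x. g x * (\<Sum>\<sigma>\<in>F. e \<sigma> * v \<sigma> x)))\<^sup>2"
    using assms(2) by (intro power_mono) auto
  also have "\<dots> \<le> ex m (\<lambda>x. (g x * (\<Sum>\<sigma>\<in>F. e \<sigma> * v \<sigma> x))\<^sup>2)"
    by (rule ex_square_le)
  also have "\<dots> \<le> B"
    unfolding power_mult_distrib by (rule B) (simp add: e_def)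
  finally show ?thesis .
qed

lemma uncountable_colour:
  fixes c :: "'i \<Rightarrow> nat"
  assumes "uncountable \<Sigma>"
  shows "\<exists>n. uncountable {\<sigma>\<in>\<Sigma>. c \<sigma> = n}"
proof (rule ccontr)
  assume "\<not> ?thesis"
  then have "countable (\<Union>n. {\<sigma>\<in>\<Sigma>. c \<sigma> = n})" by (intro countable_UN) auto
  moreover have "(\<Union>n. {\<sigma>\<in>\<Sigma>. c \<sigma> = n}) = \<Sigma>" by auto
  ultimately show False using assms by simp
qed

context ultra begin

text \<open>Each index has its own lower bound, but the countably many values
  \<open>inverse (real (Suc j))\<close> suffice, so one of them serves uncountably many
  indices.\<close>

lemma uncountable_not_tendsto:
  fixes b :: "'i \<Rightarrow> nat \<Rightarrow> real"
  assumes "uncountable \<Sigma>" "\<And>\<sigma>. \<sigma> \<in> \<Sigma> \<Longrightarrow> \<not> (b \<sigma> \<longlongrightarrow> 0) U"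
  shows "\<exists>\<Sigma>'\<subseteq>\<Sigma>. uncountable \<Sigma>' \<and> (\<exists>\<kappa>>0. \<forall>\<sigma>\<in>\<Sigma>'. \<forall>\<^sub>F N in U. \<kappa> \<le> \<bar>b \<sigma> N\<bar>)"
proof -
  have "\<exists>j. \<forall>\<^sub>F N in U. inverse (real (Suc j)) \<le> \<bar>b \<sigma> N\<bar>" if \<sigma>: "\<sigma> \<in> \<Sigma>" for \<sigma>
  proof -
    obtain \<kappa> where \<kappa>: "0 < \<kappa>" "\<forall>\<^sub>F N in U. \<kappa> \<le> \<bar>b \<sigma> N\<bar>"
      using not_tendsto_0D[OF assms(2)[OF \<sigma>]] by blast
    obtain j where j: "inverse (real (Suc j)) < \<kappa>" using reals_Archimedean[OF \<kappa>(1)] by blast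
    from \<kappa>(2) have "\<forall>\<^sub>F N in U. inverse (real (Suc j)) \<le> \<bar>b \<sigma> N\<bar>"
      by eventually_elim (use j in linarith)
    then show ?thesis by blast
  qed
  then obtain j where j: "\<And>\<sigma>. \<sigma> \<in> \<Sigma> \<Longrightarrow> \<forall>\<^sub>F N in U. inverse (real (Suc (j \<sigma>))) \<le> \<bar>b \<sigma> N\<bar>"
    using bchoice[of \<Sigma> "\<lambda>\<sigma> j. \<forall>\<^sub>F N in U. inverse (real (Suc j)) \<le> \<bar>b \<sigma> N\<bar>"] by blast
  obtain n where n: "uncountable {\<sigma>\<in>\<Sigma>. j \<sigma> = n}"
    using uncountable_colour[OF assms(1)] by blast
  show ?thesis
    using n j by (intro exI[of _ "{\<sigma>\<in>\<Sigma>. j \<sigma> = n}"] conjI exI[of _ "inverse (real (Suc n))"]) auto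
qed

text \<open>By Bessel's inequality uncountably many polynomials that correlate with \<open>g\<close> cannot be
  pairwise unbiased.\<close>

lemma uncountable_correlated:
  fixes g :: "nat \<Rightarrow> bool list \<Rightarrow> real" and q :: "'i \<Rightarrow> fseq"
  assumes "uncountable \<Sigma>" and g: "\<And>N x. \<bar>g N x\<bar> \<le> 1"
    and q: "\<And>\<sigma>. \<sigma> \<in> \<Sigma> \<Longrightarrow> \<not> ((\<lambda>N. ex (M N) (\<lambda>x. g N x * chi (q \<sigma> N x))) \<longlongrightarrow> 0) U"
  shows "\<exists>\<Sigma>'\<subseteq>\<Sigma>. uncountable \<Sigma>' \<and> (\<exists>\<tau>\<in>\<Sigma>. \<forall>\<sigma>\<in>\<Sigma>'. biased M (\<lambda>N x. q \<sigma> N x \<noteq> q \<tau> N x))"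
proof -
  obtain \<Sigma>1 \<kappa> where \<Sigma>1: "\<Sigma>1 \<subseteq> \<Sigma>" "uncountable \<Sigma>1" and \<kappa>: "0 < \<kappa>"
    "\<And>\<sigma>. \<sigma> \<in> \<Sigma>1 \<Longrightarrow> \<forall>\<^sub>F N in U. \<kappa> \<le> \<bar>ex (M N) (\<lambda>x. g N x * chi (q \<sigma> N x))\<bar>"
    using uncountable_not_tendsto[of \<Sigma> "\<lambda>\<sigma> N. ex (M N) (\<lambda>x. g N x * chi (q \<sigma> N x))"] assms(1) q
    by auto
  define I where "I \<sigma> \<tau> N = ex (M N) (\<lambda>x. chi (q \<sigma> N x) * chi (q \<tau> N x))" for \<sigma> \<tau> N
  have biased_iff: "biased M (\<lambda>N x. q \<sigma> N x \<noteq> q \<tau> N x) \<longleftrightarrow> \<not> (I \<sigma> \<tau> \<longlongrightarrow> 0) U" for \<sigma> \<tau>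
    unfolding biased_def chi_neq I_def ..
  have I_sym: "I \<sigma> \<tau> = I \<tau> \<sigma>" for \<sigma> \<tau>
    by (simp add: I_def fun_eq_iff mult.commute)
  show ?thesis
  proof (rule ccontr)
    assume no: "\<not> ?thesis"
    have countable: "countable {\<sigma>\<in>\<Sigma>1. \<not> (I \<sigma> \<tau> \<longlongrightarrow> 0) U}" if "\<tau> \<in> \<Sigma>1" for \<tau>
    proof (rule ccontr)
      assume "uncountable {\<sigma>\<in>\<Sigma>1. \<not> (I \<sigma> \<tau> \<longlongrightarrow> 0) U}"
      moreover have "\<forall>\<sigma>\<in>{\<sigma>\<in>\<Sigma>1. \<not> (I \<sigma> \<tau> \<longlongrightarrow> 0) U}. biased M (\<lambda>N x. q \<sigma> N x \<noteq> q \<tau> N x)"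
        unfolding biased_iff by simp
      moreover have "{\<sigma>\<in>\<Sigma>1. \<not> (I \<sigma> \<tau> \<longlongrightarrow> 0) U} \<subseteq> \<Sigma>" "\<tau> \<in> \<Sigma>" using \<Sigma>1(1) that by auto
      ultimately show False using no by blast
    qed
    have ex_F: "\<exists>F\<subseteq>\<Sigma>1. finite F \<and> card F = s \<and> (\<forall>\<sigma>\<in>F. \<forall>\<tau>\<in>F. \<sigma> \<noteq> \<tau> \<longrightarrow> (I \<sigma> \<tau> \<longlongrightarrow> 0) U)" for s
    proof (induction s)
      case 0
      show ?case by (intro exI[of _ "{}"]) auto
    next
      case (Suc s)
      then obtain F where F: "F \<subseteq> \<Sigma>1" "finite F" "card F = s"
        "\<And>\<sigma> \<tau>. \<sigma> \<in> F \<Longrightarrow> \<tau> \<in> F \<Longrightarrow> \<sigma> \<noteq> \<tau> \<Longrightarrow> (I \<sigma> \<tau> \<longlongrightarrow> 0) U" by blast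
      \<comment> \<open>Greedy choice: each chosen index excludes only countably many others, so the
        family can always be extended.\<close>
      have "countable (F \<union> (\<Union>\<tau>\<in>F. {\<sigma>\<in>\<Sigma>1. \<not> (I \<sigma> \<tau> \<longlongrightarrow> 0) U}))"
        using F countable by (intro countable_Un countable_UN) (auto intro: countable_finite)
      then have "\<not> \<Sigma>1 \<subseteq> F \<union> (\<Union>\<tau>\<in>F. {\<sigma>\<in>\<Sigma>1. \<not> (I \<sigma> \<tau> \<longlongrightarrow> 0) U})"
        using \<Sigma>1(2) countable_subset by blast
      then obtain \<rho> where \<rho>: "\<rho> \<in> \<Sigma>1" "\<rho> \<notin> F" "\<And>\<tau>. \<tau> \<in> F \<Longrightarrow> (I \<rho> \<tau> \<longlongrightarrow> 0) U"
        by auto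
      show ?case
        using F \<rho> I_sym by (intro exI[of _ "insert \<rho> F"]) auto
    qed
    \<comment> \<open>With off-diagonal total \<open>E N\<close> below 1, Bessel's inequality gives
      \<kappa>^2 s^2 < s + 1 \<le> 2 s, which fails for s > 2 / \<kappa>^2.\<close>
    obtain s :: nat where s: "2 / \<kappa>\<^sup>2 < real s" using reals_Archimedean2 by blast
    obtain F where F: "F \<subseteq> \<Sigma>1" "finite F" "card F = s"
      "\<forall>\<sigma>\<in>F. \<forall>\<tau>\<in>F. \<sigma> \<noteq> \<tau> \<longrightarrow> (I \<sigma> \<tau> \<longlongrightarrow> 0) U"
      using ex_F[of s] by (elim exE conjE)
    define E where "E N = (\<Sum>\<sigma>\<in>F. \<Sum>\<tau>\<in>F - {\<sigma>}. \<bar>I \<sigma> \<tau> N\<bar>)" for N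
    have "((\<lambda>N. \<bar>I \<sigma> \<tau> N\<bar>) \<longlongrightarrow> \<bar>0\<bar>) U" if "\<sigma> \<in> F" "\<tau> \<in> F - {\<sigma>}" for \<sigma> \<tau>
      using F(4) that by (intro tendsto_rabs) auto
    then have "(E \<longlongrightarrow> (\<Sum>\<sigma>\<in>F. \<Sum>\<tau>\<in>F - {\<sigma>}. \<bar>0\<bar>)) U"
      unfolding E_def by (intro tendsto_sum)
    then have "\<forall>\<^sub>F N in U. E N < 1"
      by (intro order_tendstoD(2)) auto
    moreover have "\<forall>\<^sub>F N in U. \<forall>\<sigma>\<in>F. \<kappa> \<le> \<bar>ex (M N) (\<lambda>x. g N x * chi (q \<sigma> N x))\<bar>"
      using F(1,2) \<kappa>(2) by (intro eventually_ball_finite) auto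
    ultimately have "\<forall>\<^sub>F N in U. E N < 1 \<and> (\<forall>\<sigma>\<in>F. \<kappa> \<le> \<bar>ex (M N) (\<lambda>x. g N x * chi (q \<sigma> N x))\<bar>)"
      by (rule eventually_conj)
    then obtain N where N: "E N < 1" "\<forall>\<sigma>\<in>F. \<kappa> \<le> \<bar>ex (M N) (\<lambda>x. g N x * chi (q \<sigma> N x))\<bar>"
      using eventually_happens'[OF nontriv] by blast
    have "(\<kappa> * card F)\<^sup>2 \<le> card F + E N"
    proof (rule bessel[where g = "g N" and v = "\<lambda>\<sigma> x. chi (q \<sigma> N x)"])
      fix e :: "'i \<Rightarrow> real" assume e: "\<And>\<sigma>. \<bar>e \<sigma>\<bar> = 1"
      have "ex (M N) (\<lambda>x. (g N x)\<^sup>2 * (\<Sum>\<sigma>\<in>F. e \<sigma> * chi (q \<sigma> N x))\<^sup>2)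
          \<le> ex (M N) (\<lambda>x. (\<Sum>\<sigma>\<in>F. e \<sigma> * chi (q \<sigma> N x))\<^sup>2)"
        by (intro ex_mono mult_left_le_one_le) (use g in \<open>auto simp: abs_square_le_1\<close>)
      also have "\<dots> = ex (M N) (\<lambda>x. \<Sum>\<sigma>\<in>F. \<Sum>\<tau>\<in>F. e \<sigma> * e \<tau> * (chi (q \<sigma> N x) * chi (q \<tau> N x)))"
        unfolding power2_eq_square sum_product by (intro ex_cong sum.cong) (auto simp: mult_ac)
      also have "\<dots> = (\<Sum>\<sigma>\<in>F. \<Sum>\<tau>\<in>F. e \<sigma> * e \<tau> * I \<sigma> \<tau> N)"
        unfolding ex_sum ex_cmult I_def ..
      also have "\<dots> \<le> (\<Sum>\<sigma>\<in>F. 1 + (\<Sum>\<tau>\<in>F - {\<sigma>}. \<bar>I \<sigma> \<tau> N\<bar>))"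
      proof (rule sum_mono)
        fix \<sigma> assume \<sigma>: "\<sigma> \<in> F"
        have "e \<sigma> * e \<sigma> = 1" using e[of \<sigma>] by (metis abs_mult_self_eq mult_1)
        then have "e \<sigma> * e \<sigma> * I \<sigma> \<sigma> N = 1" by (simp add: I_def)
        moreover have "(\<Sum>\<tau>\<in>F - {\<sigma>}. e \<sigma> * e \<tau> * I \<sigma> \<tau> N) \<le> (\<Sum>\<tau>\<in>F - {\<sigma>}. \<bar>I \<sigma> \<tau> N\<bar>)"
        proof (rule sum_mono)
          fix \<tau>
          have "\<bar>e \<sigma> * e \<tau> * I \<sigma> \<tau> N\<bar> = \<bar>I \<sigma> \<tau> N\<bar>" by (simp add: abs_mult e)
          then show "e \<sigma> * e \<tau> * I \<sigma> \<tau> N \<le> \<bar>I \<sigma> \<tau> N\<bar>" by linarith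
        qed
        ultimately show "(\<Sum>\<tau>\<in>F. e \<sigma> * e \<tau> * I \<sigma> \<tau> N) \<le> 1 + (\<Sum>\<tau>\<in>F - {\<sigma>}. \<bar>I \<sigma> \<tau> N\<bar>)"
          using sum.remove[OF F(2) \<sigma>, of "\<lambda>\<tau>. e \<sigma> * e \<tau> * I \<sigma> \<tau> N"] by linarith
      qed
      also have "\<dots> = card F + E N" by (simp add: E_def sum.distrib)
      finally show "ex (M N) (\<lambda>x. (g N x)\<^sup>2 * (\<Sum>\<sigma>\<in>F. e \<sigma> * chi (q \<sigma> N x))\<^sup>2) \<le> card F + E N" .
    qed (use F \<kappa> N in auto)
    moreover have "0 < 2 / \<kappa>\<^sup>2" using \<kappa>(1) by simp
    then have "1 \<le> s" using s by (metis One_nat_def Suc_leI of_nat_0_less_iff order_less_trans)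
    moreover have "2 * real s < (\<kappa> * real s)\<^sup>2"
    proof -
      have "2 < \<kappa>\<^sup>2 * real s" using s \<kappa>(1) by (simp add: field_simps)
      then have "2 * real s < (\<kappa>\<^sup>2 * real s) * real s"
        using \<open>1 \<le> s\<close> by (intro mult_strict_right_mono) auto
      then show ?thesis by (simp add: power2_eq_square mult_ac)
    qed
    ultimately show False using N(1) F(3) by simp
  qed
qed

end

text \<open>A sum of signs is an integer, and 3 divides no power of 2. This keeps a function of
  asymptotically uniform bits from having the sign mean 1/3 of Ber(1/3).\<close>

lemma dyadic_ne_third:
  assumes "finite A"
  shows "(\<Sum>B\<in>A. chi (\<Gamma> B)) / 2 ^ t \<noteq> 1/3"
proof
  assume *: "(\<Sum>B\<in>A. chi (\<Gamma> B)) / 2 ^ t = 1/3"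
  define z :: int where "z = (\<Sum>B\<in>A. if \<Gamma> B then -1 else 1)"
  have "(\<Sum>B\<in>A. chi (\<Gamma> B)) = of_int z"
    unfolding z_def of_int_sum by (intro sum.cong) auto
  with * have "real_of_int (3 * z) = real_of_int (2 ^ t)" by (simp add: field_simps)
  then have "3 * z = 2 ^ t" by linarith
  then have "3 dvd (2 :: int) ^ t" by (metis dvd_triv_left)
  moreover have "coprime (3 :: int) (2 ^ t)" by simp
  ultimately show False using coprime_common_divisor[of "3 :: int" "2 ^ t" 3] by simp
qed

text \<open>This yields a continuum of index sequences inside the sequence of output positions: two
  parameters get different indices as soon as \<open>N\<close> times their distance is at least
  1.\<close>

definition code :: "nat \<Rightarrow> real \<Rightarrow> nat" where
  "code N \<sigma> = nat \<lfloor>real N * \<sigma>\<rfloor>"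

lemma code_le: "\<sigma> \<in> {0..<1} \<Longrightarrow> code N \<sigma> \<le> N"
  unfolding code_def using mult_left_le[of \<sigma> "real N"] by (simp add: nat_le_iff floor_le_iff)

lemma code_less:
  assumes "0 \<le> \<sigma>" "\<sigma> < \<tau>"
  shows "\<forall>\<^sub>F N in sequentially. code N \<sigma> < code N \<tau>"
proof -
  obtain K :: nat where K: "1 / (\<tau> - \<sigma>) < real K" using reals_Archimedean2 by blast
  have "code N \<sigma> < code N \<tau>" if "K \<le> N" for N
  proof -
    have "1 / (\<tau> - \<sigma>) \<le> real N" using K that by linarith
    then have "real N * \<sigma> + 1 \<le> real N * \<tau>"
      using assms by (simp add: field_simps)
    then have "\<lfloor>real N * \<sigma>\<rfloor> + 1 \<le> \<lfloor>real N * \<tau>\<rfloor>" by linarith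
    moreover have "0 \<le> \<lfloor>real N * \<sigma>\<rfloor>" using assms by simp
    ultimately show ?thesis unfolding code_def by linarith
  qed
  then show ?thesis unfolding eventually_sequentially by blast
qed

context ultra begin

lemma eventually_inj_code:
  assumes "finite F" "F \<subseteq> {0..<1}"
  shows "\<forall>\<^sub>F N in U. inj_on (code N) F"
proof -
  have "\<forall>\<^sub>F N in U. \<sigma> \<noteq> \<tau> \<longrightarrow> code N \<sigma> \<noteq> code N \<tau>" if "\<sigma> \<in> F" "\<tau> \<in> F" for \<sigma> \<tau>
  proof (cases \<sigma> \<tau> rule: linorder_cases)
    case less
    then have "\<forall>\<^sub>F N in U. code N \<sigma> < code N \<tau>"
      using assms that by (intro filter_leD[OF le_seq] code_less) auto
    then show ?thesis by eventually_elim simp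
  next
    case greater
    then have "\<forall>\<^sub>F N in U. code N \<tau> < code N \<sigma>"
      using assms that by (intro filter_leD[OF le_seq] code_less) auto
    then show ?thesis by eventually_elim simp
  qed simp
  then have "\<forall>\<^sub>F N in U. \<forall>\<sigma>\<in>F. \<forall>\<tau>\<in>F. \<sigma> \<noteq> \<tau> \<longrightarrow> code N \<sigma> \<noteq> code N \<tau>"
    using assms(1) by (intro eventually_ball_finite ballI) auto
  then show ?thesis by eventually_elim (auto simp: inj_on_def)
qed

text \<open>Of the domination by independent bits only \<open>dom\<close> is kept, the second
  moments of linear forms in the centred signs; this is the form that Bessel's inequality
  consumes.\<close>

lemma no_shared_weight:
  fixes M n :: "nat \<Rightarrow> nat" and Ps :: "nat \<Rightarrow> nat \<Rightarrow> bool list \<Rightarrow> bool"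
    and w :: "nat \<Rightarrow> bool list \<Rightarrow> real"
  assumes n: "\<And>N. N < n N"
    and pol: "\<And>N i. i < n N \<Longrightarrow> deglt (M N) k (Ps N i)"
    and w: "\<And>N x. 0 \<le> w N x" "\<And>N x. w N x \<le> 1"
    and dom: "\<And>N c. ex (M N) (\<lambda>x. w N x * (\<Sum>i<n N. c i * (chi (Ps N i x) - 1/3))\<^sup>2)
      \<le> (\<Sum>i<n N. (c i)\<^sup>2)"
  shows "((\<lambda>N. ex (M N) (w N)) \<longlongrightarrow> 0) U"
proof -
  define p where "p \<sigma> = (\<lambda>N. Ps N (code N \<sigma>))" for \<sigma>
  have code_n: "code N \<sigma> < n N" if "\<sigma> \<in> {0..<1}" for N \<sigma>
    using code_le[OF that, of N] n[of N] by linarith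
  have p_Pol: "p \<sigma> \<in> Pol M k" if "\<sigma> \<in> {0..<1}" for \<sigma>
    using pol code_n[OF that] by (auto simp: p_def Pol_def)

  define wt where "wt R0 a N x = w N x * of_bool ({r \<in> R0. r N x} = a)" for R0 a N and x :: "bool list"
  have wt: "0 \<le> wt R0 a N x" "wt R0 a N x \<le> w N x" "\<bar>wt R0 a N x\<bar> \<le> 1" for R0 a N x
    using w[of N x] by (auto simp: wt_def)

  have dom_p: "ex (M N) (\<lambda>x. w N x * (\<Sum>\<sigma>\<in>F. e \<sigma> * (chi (p \<sigma> N x) - 1/3))\<^sup>2) \<le> real (card F)"
    if F: "finite F" "F \<subseteq> {0..<1}" and inj: "inj_on (code N) F" and e: "\<And>\<sigma>. \<bar>e \<sigma>\<bar> = (1::real)" for F e N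
  proof -
    \<comment> \<open>The coefficients are carried from parameters to output positions, with 0
      elsewhere; injectivity keeps two parameters from sharing a position.\<close>
    define c where "c i = (if i \<in> code N ` F then e (inv_into F (code N) i) else 0)" for i
    have c: "c (code N \<sigma>) = e \<sigma>" if "\<sigma> \<in> F" for \<sigma>
      using that inj by (simp add: c_def)
    have sub: "code N ` F \<subseteq> {..<n N}" using F code_n by auto
    \<comment> \<open>The general \<open>h\<close> covers both the squares of the coefficients and
      the linear form at each \<open>x\<close>.\<close>
    have *: "(\<Sum>i<n N. h (c i) i) = (\<Sum>\<sigma>\<in>F. h (e \<sigma>) (code N \<sigma>))" if "\<And>i. h 0 i = 0"
      for h :: "real \<Rightarrow> nat \<Rightarrow> real"
    proof -
      have "(\<Sum>i<n N. h (c i) i) = (\<Sum>i\<in>code N ` F. h (c i) i)"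
        by (intro sum.mono_neutral_right sub) (auto simp: c_def that)
      also have "\<dots> = (\<Sum>\<sigma>\<in>F. h (c (code N \<sigma>)) (code N \<sigma>))"
        by (simp add: sum.reindex[OF inj])
      finally show ?thesis by (simp add: c)
    qed
    have "e \<sigma> * e \<sigma> = 1" for \<sigma> using e[of \<sigma>] by (metis abs_mult_self_eq mult_1)
    then show ?thesis
      using dom[of N c] *[of "\<lambda>t i. t\<^sup>2"] *[of "\<lambda>t i. t * (chi (Ps N i x) - 1/3)" for x]
      by (simp add: p_def power2_eq_square)
  qed

  define Bad where "Bad R0 a = {\<sigma> \<in> {0..<1}.
      \<not> ((\<lambda>N. ex (M N) (\<lambda>x. wt R0 a N x * (chi (p \<sigma> N x) - 1/3))) \<longlongrightarrow> 0) U}" for R0 a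
  have Bad: "countable (Bad R0 a)" for R0 a
  proof (rule ccontr)
    assume "uncountable (Bad R0 a)"
    then have "\<exists>\<Sigma>'\<subseteq>Bad R0 a. uncountable \<Sigma>' \<and> (\<exists>\<kappa>>0. \<forall>\<sigma>\<in>\<Sigma>'. \<forall>\<^sub>F N in U.
        \<kappa> \<le> \<bar>ex (M N) (\<lambda>x. wt R0 a N x * (chi (p \<sigma> N x) - 1/3))\<bar>)"
      by (rule uncountable_not_tendsto) (simp add: Bad_def)
    then obtain \<Sigma>' \<kappa> where \<Sigma>': "\<Sigma>' \<subseteq> {0..<1}" "uncountable \<Sigma>'" and \<kappa>: "0 < \<kappa>"
      "\<forall>\<sigma>\<in>\<Sigma>'. \<forall>\<^sub>F N in U. \<kappa> \<le> \<bar>ex (M N) (\<lambda>x. wt R0 a N x * (chi (p \<sigma> N x) - 1/3))\<bar>"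
      by (elim exE conjE) (rule that, auto simp: Bad_def)
    \<comment> \<open>Bessel's inequality with bound \<open>s\<close> would give \<kappa>^2 s^2
      \<le> s, which fails for s > 1 / \<kappa>^2.\<close>
    obtain s :: nat where s: "1 / \<kappa>\<^sup>2 < real s" using reals_Archimedean2 by blast
    have "infinite \<Sigma>'" using \<Sigma>'(2) countable_finite by blast
    then obtain F where F: "F \<subseteq> \<Sigma>'" "finite F" "card F = s"
      using infinite_arbitrarily_large by metis
    have "\<forall>\<^sub>F N in U. \<forall>\<sigma>\<in>F. \<kappa> \<le> \<bar>ex (M N) (\<lambda>x. wt R0 a N x * (chi (p \<sigma> N x) - 1/3))\<bar>"
      using F \<kappa>(2) by (intro eventually_ball_finite) auto
    moreover have "\<forall>\<^sub>F N in U. inj_on (code N) F"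
      using F \<Sigma>'(1) by (intro eventually_inj_code) auto
    ultimately have "\<forall>\<^sub>F N in U. (\<forall>\<sigma>\<in>F. \<kappa> \<le> \<bar>ex (M N) (\<lambda>x. wt R0 a N x * (chi (p \<sigma> N x) - 1/3))\<bar>)
        \<and> inj_on (code N) F"
      by (rule eventually_conj)
    then obtain N where N: "\<forall>\<sigma>\<in>F. \<kappa> \<le> \<bar>ex (M N) (\<lambda>x. wt R0 a N x * (chi (p \<sigma> N x) - 1/3))\<bar>"
      "inj_on (code N) F"
      using eventually_happens'[OF nontriv] by blast
    have "(\<kappa> * card F)\<^sup>2 \<le> card F"
    proof (rule bessel[where g = "wt R0 a N" and v = "\<lambda>\<sigma> x. chi (p \<sigma> N x) - 1/3"])
      fix e :: "real \<Rightarrow> real" assume e: "\<And>\<sigma>. \<bar>e \<sigma>\<bar> = 1"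
      have "(wt R0 a N x)\<^sup>2 \<le> w N x" for x
      proof -
        have "(wt R0 a N x)\<^sup>2 \<le> wt R0 a N x"
          using wt[of R0 a N x] by (simp add: power2_eq_square mult_left_le)
        then show ?thesis using wt(2)[of R0 a N x] by linarith
      qed
      then have "ex (M N) (\<lambda>x. (wt R0 a N x)\<^sup>2 * (\<Sum>\<sigma>\<in>F. e \<sigma> * (chi (p \<sigma> N x) - 1/3))\<^sup>2)
          \<le> ex (M N) (\<lambda>x. w N x * (\<Sum>\<sigma>\<in>F. e \<sigma> * (chi (p \<sigma> N x) - 1/3))\<^sup>2)"
        by (intro ex_mono mult_right_mono) auto
      also have "\<dots> \<le> card F"
        using F \<Sigma>'(1) N(2) e by (intro dom_p) auto
      finally show "ex (M N) (\<lambda>x. (wt R0 a N x)\<^sup>2 * (\<Sum>\<sigma>\<in>F. e \<sigma> * (chi (p \<sigma> N x) - 1/3))\<^sup>2)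
          \<le> card F" .
    qed (use F \<kappa> N in auto)
    moreover have "0 < 1 / \<kappa>\<^sup>2" using \<kappa>(1) by simp
    then have "0 < s" using s by (metis of_nat_0_less_iff order_less_trans)
    moreover have "1 < \<kappa>\<^sup>2 * real s" using s \<kappa>(1) by (simp add: field_simps)
    then have "1 * real s < (\<kappa>\<^sup>2 * real s) * real s"
      using \<open>0 < s\<close> by (intro mult_strict_right_mono) auto
    ultimately show False using F(3) by (simp add: power2_eq_square mult_ac)
  qed

  define neut where "neut R0 q \<longleftrightarrow>
    (\<forall>a\<in>Pow R0. ((\<lambda>N. ex (M N) (\<lambda>x. wt R0 a N x * chi (q N x))) \<longlongrightarrow> 0) U)" for R0 q
  have "uncountable {0..<1::real}" by (simp add: uncountable_half_open_interval_1)
  \<comment> \<open>Regularization starts from one multiset of degrees for all indices, here the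
    singleton \<open>{#j#}\<close>.\<close>
  then obtain j where j: "uncountable {\<sigma> \<in> {0..<1}. sdeg M (p \<sigma>) = j}"
    using uncountable_colour[of "{0..<1}" "\<lambda>\<sigma>. sdeg M (p \<sigma>)"] by blast
  let ?\<Sigma> = "{\<sigma> \<in> {0..<1}. sdeg M (p \<sigma>) = j}"
  have "\<exists>\<Sigma>'\<subseteq>?\<Sigma>. uncountable \<Sigma>' \<and> (\<exists>R0' R1'. finite R0' \<and> {} \<subseteq> R0' \<and> R0' \<subseteq> UNIV \<and>
      (\<forall>\<sigma>\<in>\<Sigma>'. finite (R1' \<sigma>) \<and> (\<forall>r\<in>{p \<sigma>}. alg M (R0' \<union> R1' \<sigma>) r) \<and>
        (\<forall>C\<subseteq>R1' \<sigma>. C \<noteq> {} \<longrightarrow> neut R0' (comb C))))"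
  proof (rule regularization[where K = k and D = "{#j#}"])
    show "\<exists>m. uncountable {\<sigma> \<in> \<Sigma>. c \<sigma> = m}" if "uncountable \<Sigma>" for \<Sigma> and c :: "real \<Rightarrow> nat"
      using that by (rule uncountable_colour)
    show "\<exists>T. finite T \<and> T \<subseteq> (\<Union>j<i. Pol M j) \<and> alg M T f"
      if "i \<le> k" "f \<in> Pol M i" "biased M f" for i f
      using that(2,3) by (rule biased_struct)
    show "\<exists>\<Sigma>'\<subseteq>\<Sigma>. uncountable \<Sigma>' \<and> (\<exists>q0\<in>UNIV \<inter> Pol M i. \<forall>\<sigma>\<in>\<Sigma>'. biased M (\<lambda>N x. q \<sigma> N x \<noteq> q0 N x))"
      if unc: "uncountable \<Sigma>" and fin: "finite R0"
        and q: "\<And>\<sigma>. \<sigma> \<in> \<Sigma> \<Longrightarrow> q \<sigma> \<in> Pol M i \<and> \<not> neut R0 (q \<sigma>)"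
      for \<Sigma> :: "real set" and i R0 q
    proof -
      define S where "S a = {\<sigma> \<in> \<Sigma>. \<not> ((\<lambda>N. ex (M N) (\<lambda>x. wt R0 a N x * chi (q \<sigma> N x))) \<longlongrightarrow> 0) U}" for a
      have "\<Sigma> = (\<Union>a\<in>Pow R0. S a)" using q by (auto simp: neut_def S_def)
      moreover have "countable (Pow R0)" using fin by (simp add: countable_finite)
      \<comment> \<open>There are finitely many atoms, so a single one accounts for uncountably many
        failures of neutrality and provides the fixed weight for Bessel's inequality.\<close>
      ultimately obtain a where a: "uncountable (S a)"
        using unc countable_UN[of "Pow R0" S] by auto
      have "\<exists>\<Sigma>'\<subseteq>S a. uncountable \<Sigma>' \<and> (\<exists>\<tau>\<in>S a. \<forall>\<sigma>\<in>\<Sigma>'. biased M (\<lambda>N x. q \<sigma> N x \<noteq> q \<tau> N x))"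
        by (rule uncountable_correlated[OF a, where g = "wt R0 a"]) (use wt(3) in \<open>auto simp: S_def\<close>)
      then obtain \<Sigma>' \<tau> where "\<Sigma>' \<subseteq> S a" "uncountable \<Sigma>'" "\<tau> \<in> S a"
        "\<forall>\<sigma>\<in>\<Sigma>'. biased M (\<lambda>N x. q \<sigma> N x \<noteq> q \<tau> N x)" by blast
      moreover have "S a \<subseteq> \<Sigma>" by (auto simp: S_def)
      ultimately show ?thesis
        using q by (intro exI[of _ \<Sigma>'] conjI bexI[of _ "q \<tau>"]) auto
    qed
  qed (use j p_Pol in auto)
  then obtain \<Sigma>' R0 R1 where R: "\<Sigma>' \<subseteq> {0..<1}" "uncountable \<Sigma>'" "finite R0"
    "\<forall>\<sigma>\<in>\<Sigma>'. finite (R1 \<sigma>) \<and> (\<forall>r\<in>{p \<sigma>}. alg M (R0 \<union> R1 \<sigma>) r) \<and>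
        (\<forall>C\<subseteq>R1 \<sigma>. C \<noteq> {} \<longrightarrow> neut R0 (comb C))"
    by (elim exE conjE) (rule that, auto)
  \<comment> \<open>\<open>R0\<close> is the same for all parameters, so those that are bad on some
    atom are countably many; one parameter outside them settles all atoms.\<close>
  have "countable (\<Union>a\<in>Pow R0. Bad R0 a)"
    using R(3) Bad by (intro countable_UN) (auto simp: countable_finite)
  then have "\<not> \<Sigma>' \<subseteq> (\<Union>a\<in>Pow R0. Bad R0 a)" using R(2) countable_subset by blast
  then obtain \<sigma> where \<sigma>: "\<sigma> \<in> \<Sigma>'" "\<And>a. a \<in> Pow R0 \<Longrightarrow> \<sigma> \<notin> Bad R0 a" by blast
  have R1: "finite (R1 \<sigma>)" "alg M (R0 \<union> R1 \<sigma>) (p \<sigma>)"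
    "\<And>C. C \<subseteq> R1 \<sigma> \<Longrightarrow> C \<noteq> {} \<Longrightarrow> neut R0 (comb C)"
    using R(4) \<sigma>(1) by auto
  obtain \<Gamma> where \<Gamma>: "null M (\<lambda>N x. p \<sigma> N x \<noteq> \<Gamma> {r \<in> R0 \<union> R1 \<sigma>. r N x})"
    using R1(2) unfolding alg_def by (elim exE)
  obtain c where c: "\<And>N x. chi (\<Gamma> {r \<in> R0 \<union> R1 \<sigma>. r N x}) =
      (\<Sum>C\<in>Pow (R1 \<sigma>). c {r \<in> R0. r N x} C * chi (comb C N x))"
    "\<And>a. c a {} = (\<Sum>B\<in>Pow (R1 \<sigma>). chi (\<Gamma> (a \<union> B))) / 2 ^ card (R1 \<sigma>)"
    using walsh_profile[OF R1(1), of \<Gamma> R0 thesis] by (rule meta_mp) (rule that)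

  have small: "((\<lambda>N. ex (M N) (wt R0 a N)) \<longlongrightarrow> 0) U" if a: "a \<in> Pow R0" for a
  proof -
    let ?g = "wt R0 a"
    define e where "e N = ex (M N) (\<lambda>x. of_bool (p \<sigma> N x \<noteq> \<Gamma> {r \<in> R0 \<union> R1 \<sigma>. r N x}))" for N
    define V where "V C N = ex (M N) (\<lambda>x. ?g N x * chi (comb C N x))" for C N
    have V: "(V C \<longlongrightarrow> 0) U" if "C \<in> Pow (R1 \<sigma>) - {{}}" for C
      using R1(3)[of C] that a unfolding neut_def V_def by blast
    have "((\<lambda>N. ex (M N) (\<lambda>x. ?g N x * (chi (p \<sigma> N x) - chi (\<Gamma> {r \<in> R0 \<union> R1 \<sigma>. r N x})))) \<longlongrightarrow> 0) U"
    proof (rule tendsto_rabs_zero_cancel, rule tendsto_0_mono)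
      show "((\<lambda>N. 2 * e N) \<longlongrightarrow> 0) U"
        using tendsto_mult[OF tendsto_const[of 2] \<Gamma>[unfolded null_def]] by (simp add: e_def)
      show "\<bar>ex (M N) (\<lambda>x. ?g N x * (chi (p \<sigma> N x) - chi (\<Gamma> {r \<in> R0 \<union> R1 \<sigma>. r N x})))\<bar> \<le> 2 * e N" for N
      proof -
        have "\<bar>?g N x * (chi (p \<sigma> N x) - chi (\<Gamma> {r \<in> R0 \<union> R1 \<sigma>. r N x}))\<bar>
            \<le> 2 * of_bool (p \<sigma> N x \<noteq> \<Gamma> {r \<in> R0 \<union> R1 \<sigma>. r N x})" for x
          using wt(3)[of R0 a N x] by (auto simp: abs_mult chi_def)
        then have "ex (M N) (\<lambda>x. \<bar>?g N x * (chi (p \<sigma> N x) - chi (\<Gamma> {r \<in> R0 \<union> R1 \<sigma>. r N x}))\<bar>)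
            \<le> 2 * e N"
          unfolding e_def by (subst ex_cmult[symmetric]) (intro ex_mono)
        then show ?thesis by (rule order_trans[OF ex_abs])
      qed
    qed simp
    \<comment> \<open>The weight vanishes off the atom, so the coefficients may be taken at the
      fixed profile \<open>a\<close>.\<close>
    moreover have "ex (M N) (\<lambda>x. ?g N x * chi (\<Gamma> {r \<in> R0 \<union> R1 \<sigma>. r N x}))
        = c a {} * ex (M N) (?g N) + (\<Sum>C\<in>Pow (R1 \<sigma>) - {{}}. c a C * V C N)" for N
    proof -
      have "ex (M N) (\<lambda>x. ?g N x * chi (\<Gamma> {r \<in> R0 \<union> R1 \<sigma>. r N x}))
          = ex (M N) (\<lambda>x. \<Sum>C\<in>Pow (R1 \<sigma>). c a C * (?g N x * chi (comb C N x)))"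
        unfolding c by (intro ex_cong) (auto simp: wt_def sum_distrib_left mult_ac intro!: sum.cong)
      also have "\<dots> = (\<Sum>C\<in>Pow (R1 \<sigma>). c a C * V C N)"
        unfolding ex_sum ex_cmult V_def ..
      also have "\<dots> = c a {} * V {} N + (\<Sum>C\<in>Pow (R1 \<sigma>) - {{}}. c a C * V C N)"
        using R1(1) by (intro sum.remove) auto
      finally show ?thesis by (simp add: V_def comb_def)
    qed
    moreover have "((\<lambda>N. \<Sum>C\<in>Pow (R1 \<sigma>) - {{}}. c a C * V C N) \<longlongrightarrow> (\<Sum>C\<in>Pow (R1 \<sigma>) - {{}}. c a C * 0)) U"
      by (intro tendsto_intros V)
    moreover have "((\<lambda>N. ex (M N) (\<lambda>x. ?g N x * (chi (p \<sigma> N x) - 1/3))) \<longlongrightarrow> 0) U"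
      using \<sigma>(2)[OF a] \<sigma>(1) R(1) by (auto simp: Bad_def)
    ultimately have "((\<lambda>N. (ex (M N) (\<lambda>x. ?g N x * (chi (p \<sigma> N x) - chi (\<Gamma> {r \<in> R0 \<union> R1 \<sigma>. r N x})))
        - ex (M N) (\<lambda>x. ?g N x * (chi (p \<sigma> N x) - 1/3)))
        + (\<Sum>C\<in>Pow (R1 \<sigma>) - {{}}. c a C * V C N)) \<longlongrightarrow> 0) U"
      using tendsto_add[OF tendsto_diff] by fastforce
    \<comment> \<open>The same sign average is evaluated twice, up to null terms: as
      \<open>c a {}\<close> times the mass by the Walsh expansion, and as 1/3 of the mass by
      domination.\<close>
    moreover have "(ex (M N) (\<lambda>x. ?g N x * (chi (p \<sigma> N x) - chi (\<Gamma> {r \<in> R0 \<union> R1 \<sigma>. r N x})))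
        - ex (M N) (\<lambda>x. ?g N x * (chi (p \<sigma> N x) - 1/3)))
        + (\<Sum>C\<in>Pow (R1 \<sigma>) - {{}}. c a C * V C N) = (1/3 - c a {}) * ex (M N) (?g N)" for N
    proof -
      have "ex (M N) (\<lambda>x. ?g N x * (chi (p \<sigma> N x) - t x))
          = ex (M N) (\<lambda>x. ?g N x * chi (p \<sigma> N x)) - ex (M N) (\<lambda>x. ?g N x * t x)" for t
        unfolding right_diff_distrib ex_diff ..
      note this[of "\<lambda>_. 1/3"] this[of "\<lambda>x. chi (\<Gamma> {r \<in> R0 \<union> R1 \<sigma>. r N x})"]
      moreover have "ex (M N) (\<lambda>x. ?g N x * (1/3)) = ex (M N) (?g N) * (1/3)"
        by (rule ex_multc)
      ultimately show ?thesis
        using \<open>\<And>N. ex (M N) (\<lambda>x. ?g N x * chi (\<Gamma> {r \<in> R0 \<union> R1 \<sigma>. r N x})) = _ N\<close>[of N]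
        by (simp add: algebra_simps)
    qed
    ultimately have "((\<lambda>N. (1/3 - c a {}) * ex (M N) (?g N)) \<longlongrightarrow> 0) U" by simp
    moreover have "1/3 - c a {} \<noteq> 0"
      using dyadic_ne_third[of "Pow (R1 \<sigma>)" "\<lambda>B. \<Gamma> (a \<union> B)" "card (R1 \<sigma>)"] R1(1) c(2)[of a] by simp
    ultimately show ?thesis
      using tendsto_mult_left_iff[of "1/3 - c a {}" "\<lambda>N. ex (M N) (?g N)" 0 U] by simp
  qed
  \<comment> \<open>Finitely many atoms partition the cube, so their weights add up to
    \<open>w\<close>.\<close>
  have "((\<lambda>N. \<Sum>a\<in>Pow R0. ex (M N) (wt R0 a N)) \<longlongrightarrow> (\<Sum>a\<in>Pow R0. 0)) U"
    by (intro tendsto_sum small)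
  moreover have "(\<Sum>a\<in>Pow R0. ex (M N) (wt R0 a N)) = ex (M N) (w N)" for N
  proof -
    have "(\<Sum>a\<in>Pow R0. wt R0 a N x) = w N x" for x
    proof -
      have "(\<Sum>a\<in>Pow R0. wt R0 a N x) = (\<Sum>a\<in>Pow R0. if a = {r \<in> R0. r N x} then w N x else 0)"
        by (intro sum.cong) (auto simp: wt_def)
      then show ?thesis using R(3) by (simp add: sum.delta)
    qed
    then show ?thesis unfolding ex_sum[symmetric] by simp
  qed
  ultimately show ?thesis by simp
qed

end

section \<open>Uniform lower bound and the theorem\<close>

lemma tv_dist_nonneg: "0 \<le> tv_dist n p q"
  by (simp add: tv_dist_def sum_nonneg)

lemma tv_dist_ge_eventually:
  fixes d :: nat and \<epsilon> :: real
  assumes "0 < \<epsilon>"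
  shows "\<exists>N0. \<forall>n\<ge>N0. \<forall>m Ps. (\<forall>i<n. poly_deg_le m d (Ps i)) \<longrightarrow>
    1 - \<epsilon> \<le> tv_dist n (poly_distr m n Ps) (ber13 n)"
proof (rule ccontr)
  assume no: "\<not> ?thesis"
  have "\<forall>N::nat. \<exists>n m Ps w. N < n \<and> (\<forall>i<n. poly_deg_le m d (Ps i)) \<and>
      (\<forall>x. 0 \<le> w x) \<and> (\<forall>x. w x \<le> 1) \<and> \<epsilon> \<le> ex m w \<and>
      (\<forall>c. ex m (\<lambda>x. w x * (\<Sum>i<n. c i * (chi (Ps i x) - 1/3))\<^sup>2) \<le> (\<Sum>i<n. (c i)\<^sup>2))"
  proof
    fix N :: nat
    \<comment> \<open>The threshold \<open>Suc N\<close> makes \<open>N < n\<close> strict, so that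
      the positions \<open>code N \<sigma>\<close>, which can be as large as \<open>N\<close>, are
      valid.\<close>
    from no have "\<exists>n\<ge>Suc N. \<exists>m Ps. (\<forall>i<n. poly_deg_le m d (Ps i)) \<and>
        tv_dist n (poly_distr m n Ps) (ber13 n) < 1 - \<epsilon>"
      by (simp add: not_le)
    then obtain n m Ps where n: "Suc N \<le> n" "\<forall>i<n. poly_deg_le m d (Ps i)"
      and tv: "tv_dist n (poly_distr m n Ps) (ber13 n) < 1 - \<epsilon>"
      by (elim exE conjE)
    obtain w :: "bool list \<Rightarrow> real" where "\<And>x. 0 \<le> w x" "\<And>x. w x \<le> 1" "\<epsilon> \<le> ex m w"
      "\<And>c. ex m (\<lambda>x. w x * (\<Sum>i<n. c i * (chi (Ps i x) - 1/3))\<^sup>2) \<le> (\<Sum>i<n. (c i)\<^sup>2)"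
      by (rule shared_weight[OF tv]) (rule that)
    with n show "\<exists>n m Ps w. N < n \<and> (\<forall>i<n. poly_deg_le m d (Ps i)) \<and>
      (\<forall>x. 0 \<le> w x) \<and> (\<forall>x. w x \<le> 1) \<and> \<epsilon> \<le> ex m w \<and>
      (\<forall>c. ex m (\<lambda>x. w x * (\<Sum>i<n. c i * (chi (Ps i x) - 1/3))\<^sup>2) \<le> (\<Sum>i<n. (c i)\<^sup>2))"
      by (intro exI[of _ n] exI[of _ m] exI[of _ Ps] exI[of _ w]) auto
  qed
  then obtain n m Ps w where *: "\<forall>N::nat. N < n N \<and> (\<forall>i<n N. poly_deg_le (m N) d (Ps N i)) \<and>
      (\<forall>x. 0 \<le> w N x) \<and> (\<forall>x. w N x \<le> 1) \<and> \<epsilon> \<le> ex (m N) (w N) \<and>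
      (\<forall>c. ex (m N) (\<lambda>x. w N x * (\<Sum>i<n N. c i * (chi (Ps N i x) - 1/3))\<^sup>2) \<le> (\<Sum>i<n N. (c i)\<^sup>2))"
    unfolding choice_iff by (elim exE) (rule that)
  obtain U :: "nat filter" where U: "U \<noteq> bot" "U \<le> sequentially"
    "\<And>P. eventually P U \<or> eventually (\<lambda>n. \<not> P n) U"
    using ex_ultrafilter_sequentially by blast
  interpret ultra U using U by unfold_locales
  have "((\<lambda>N. ex (m N) (w N)) \<longlongrightarrow> 0) U"
    by (rule no_shared_weight[where n = n and Ps = Ps and k = "Suc d"])
       (use * in \<open>auto intro: deglt_poly simp del: deglt.simps\<close>)
  then have "\<forall>\<^sub>F N in U. ex (m N) (w N) < \<epsilon>"
    using assms by (rule order_tendstoD)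
  then have "\<exists>N. ex (m N) (w N) < \<epsilon>"
    using eventually_happens'[OF U(1)] by blast
  with * show False by (meson not_le)
qed

theorem theorem12p2:
  shows "(\<exists>C::real. C > 0 \<and>
           (\<forall>\<epsilon>::real. 0 < \<epsilon> \<and> \<epsilon> \<le> 1 \<longrightarrow> (\<forall>d::nat.
             (\<exists>\<epsilon>'::real. \<exists>d'::real. \<epsilon>' > 0 \<and> d' > 0 \<and>
               (\<forall>n m::nat. \<forall>Ps::nat \<Rightarrow> bool list \<Rightarrow> bool.
                  n \<ge> 1 \<longrightarrow> (\<forall>i<n. poly_deg_le m d (Ps i)) \<longrightarrow>
                  tv_dist n (poly_distr m n Ps) (ber13 n)
                    \<ge> 1 - C * d' * real n powr (- \<epsilon>') - C * \<epsilon>)))))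
       \<and> (\<forall>d::nat. \<exists>\<eta>::nat \<Rightarrow> real. \<eta> \<longlonglongrightarrow> 0 \<and>
           (\<forall>n m::nat. \<forall>Ps::nat \<Rightarrow> bool list \<Rightarrow> bool.
              n \<ge> 1 \<longrightarrow> (\<forall>i<n. poly_deg_le m d (Ps i)) \<longrightarrow>
              tv_dist n (poly_distr m n Ps) (ber13 n) \<ge> 1 - \<eta> n))"
proof (rule conjI, rule exI[of _ 1], intro conjI allI impI, rule_tac [3] allI)
  fix \<epsilon> :: real and d :: nat
  assume \<epsilon>: "0 < \<epsilon> \<and> \<epsilon> \<le> 1"
  then obtain N0 where N0: "\<And>n m Ps. N0 \<le> n \<Longrightarrow> \<forall>i<n. poly_deg_le m d (Ps i) \<Longrightarrow>
      1 - \<epsilon> \<le> tv_dist n (poly_distr m n Ps) (ber13 n)"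
    using tv_dist_ge_eventually[of \<epsilon> d] by blast
  show "\<exists>\<epsilon>' d'. \<epsilon>' > 0 \<and> d' > 0 \<and>
      (\<forall>n m Ps. n \<ge> 1 \<longrightarrow> (\<forall>i<n. poly_deg_le m d (Ps i)) \<longrightarrow>
        tv_dist n (poly_distr m n Ps) (ber13 n) \<ge> 1 - 1 * d' * real n powr (- \<epsilon>') - 1 * \<epsilon>)"
  \<comment> \<open>With exponent 1 and \<open>d'\<close> above the threshold \<open>N0\<close>, the
    subtracted term is at least 1 for n < \<open>N0\<close>, where the bound is trivial; beyond
    \<open>N0\<close> the term \<epsilon> suffices.\<close>
  proof (rule exI[of _ 1], rule exI[of _ "real (Suc N0)"], intro conjI allI impI)
    fix n m :: nat and Ps :: "nat \<Rightarrow> bool list \<Rightarrow> bool"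
    assume n: "1 \<le> n" and Ps: "\<forall>i<n. poly_deg_le m d (Ps i)"
    have powr: "real n powr - 1 = 1 / real n" using n by (simp add: powr_minus_divide)
    show "1 - 1 * real (Suc N0) * real n powr - 1 - 1 * \<epsilon> \<le> tv_dist n (poly_distr m n Ps) (ber13 n)"
    proof (cases "N0 \<le> n")
      case True
      have "0 \<le> real (Suc N0) * (1 / real n)" by simp
      then show ?thesis
        using N0[OF True Ps] unfolding powr mult_1_left by linarith
    next
      case False
      then have "1 \<le> real (Suc N0) * (1 / real n)" using n by (simp add: field_simps)
      then show ?thesis
        using \<epsilon> tv_dist_nonneg[of n "poly_distr m n Ps" "ber13 n"] unfolding powr mult_1_left by linarith
    qed
  qed simp_all
next
  fix d :: nat
  \<comment> \<open>\<open>\<eta> n\<close> is the worst deficit over all dimensions and all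
    polynomial maps. The inserted 0 makes it nonnegative, and nonnegativity of the distance bounds
    the set by 1.\<close>
  define D where "D n = insert 0 {1 - tv_dist n (poly_distr m n Ps) (ber13 n) | m Ps.
      \<forall>i<n. poly_deg_le m d (Ps i)}" for n
  define \<eta> where "\<eta> n = Sup (D n)" for n
  have bdd: "bdd_above (D n)" for n
    unfolding D_def using tv_dist_nonneg by (auto intro!: bdd_aboveI[of _ 1])
  have "\<eta> \<longlonglongrightarrow> 0"
  proof (rule LIMSEQ_I)
    fix r :: real assume r: "0 < r"
    then obtain N0 where N0: "\<And>n m Ps. N0 \<le> n \<Longrightarrow> \<forall>i<n. poly_deg_le m d (Ps i) \<Longrightarrow>
        1 - r / 2 \<le> tv_dist n (poly_distr m n Ps) (ber13 n)"
      using tv_dist_ge_eventually[OF half_gt_zero[OF r], of d] by blast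
    have "norm (\<eta> n - 0) < r" if "N0 \<le> n" for n
    proof -
      have "\<eta> n \<le> r / 2"
        unfolding \<eta>_def by (rule cSup_least) (use N0[OF that] r in \<open>force simp: D_def\<close>)+
      moreover have "0 \<le> \<eta> n"
        unfolding \<eta>_def by (rule cSup_upper[OF _ bdd]) (simp add: D_def)
      ultimately show ?thesis using r by simp
    qed
    then show "\<exists>N0. \<forall>n\<ge>N0. norm (\<eta> n - 0) < r" by blast
  qed
  moreover have "1 - \<eta> n \<le> tv_dist n (poly_distr m n Ps) (ber13 n)"
    if "\<forall>i<n. poly_deg_le m d (Ps i)" for n m Ps
  proof -
    have "1 - tv_dist n (poly_distr m n Ps) (ber13 n) \<le> \<eta> n"
      unfolding \<eta>_def by (rule cSup_upper[OF _ bdd]) (use that in \<open>auto simp: D_def\<close>)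
    then show ?thesis by simp
  qed
  ultimately show "\<exists>\<eta>::nat \<Rightarrow> real. \<eta> \<longlonglongrightarrow> 0 \<and>
      (\<forall>n m Ps. 1 \<le> n \<longrightarrow> (\<forall>i<n. poly_deg_le m d (Ps i)) \<longrightarrow>
        1 - \<eta> n \<le> tv_dist n (poly_distr m n Ps) (ber13 n))"
    by blast
qed simp

end
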